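(* Let $L/K$ be a finite separable extension of local fields, let $n=[L:K]$, and let $\mathbb{F}_q$ be the residue field of $K$. Suppose $L/K$ is totally ramified and $\gcd(n,q)=1$. Then the following are equivalent: (1) $L/K$ is exceptional; (2) $\gcd(n,q-1)=1$; (3) $K$ contains no $n$-th root of unity other than $1$; (4) there is no intermediate field $M$ of $L/K$ with $M\neq K$ such that $M/K$ is a Galois extension.
   Context: A local field is a field complete with respect to a discrete valuation and having finite residue field. For a finite separable extension $L/K$ of local fields, let $N$ be the Galois closure of $L/K$. The extension $L/K$ is called exceptional if (a) $L/K$ is totally ramified, and (b) for every $\sigma\in \mathrm{Gal}(N/K)\setminus\mathrm{Gal}(N/L)$, the compositum $L.\sigma(L)$ (taken inside $N$) is not totally ramified over $K$. *)

theory Defs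
  imports "HOL-Analysis.Abstract_Metric_Spaces" "HOL-Algebra.Algebra"
    "HOL-Algebra.Algebraic_Closure_Type"
begin

text \<open>
  All fields are subfields, given as sets, of one ambient field, which is an arbitrary type of
  class \<open>field\<close>. Its \<open>HOL-Algebra\<close> incarnation \<open>ring_of_type_algebra\<close> makes the library notions
  of subfield, dimension, generated subfield, quotient ring and isomorphism available.
\<close>

abbreviation amb :: "'a::field ring" where
  "amb \<equiv> ring_of_type_algebra"

abbreviation sub_struct :: "'a::field set \<Rightarrow> 'a ring" where
  "sub_struct S \<equiv> amb\<lparr>carrier := S\<rparr>"


section \<open>Field extensions\<close>

definition field_ext :: "'a::field set \<Rightarrow> 'a set \<Rightarrow> bool" where
  "field_ext K L \<longleftrightarrow> subfield K amb \<and> subfield L amb \<and> K \<subseteq> L"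

definition finite_ext :: "'a::field set \<Rightarrow> 'a set \<Rightarrow> bool" where
  "finite_ext K L \<longleftrightarrow> field_ext K L \<and> ring.finite_dimension amb K L"

definition ext_degree :: "'a::field set \<Rightarrow> 'a set \<Rightarrow> nat" where
  "ext_degree K L = ring.dim amb K L"

definition poly_over :: "'a::field set \<Rightarrow> 'a poly \<Rightarrow> bool" where
  "poly_over K p \<longleftrightarrow> (\<forall>i. Polynomial.coeff p i \<in> K)"

definition is_min_poly :: "'a::field set \<Rightarrow> 'a \<Rightarrow> 'a poly \<Rightarrow> bool" where
  "is_min_poly K x p \<longleftrightarrow>
     poly_over K p \<and> Polynomial.lead_coeff p = 1 \<and> poly p x = 0 \<and>
     (\<forall>g. poly_over K g \<and> g \<noteq> 0 \<and> poly g x = 0 \<longrightarrow> Polynomial.degree p \<le> Polynomial.degree g)"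

text \<open>
  Separability: the minimal polynomials have only simple roots in an algebraic closure
  (that of the ambient field). Both notions below include that the extension is algebraic.
\<close>

definition separable_ext :: "'a::field set \<Rightarrow> 'a set \<Rightarrow> bool" where
  "separable_ext K L \<longleftrightarrow> field_ext K L \<and>
     (\<forall>x\<in>L. \<exists>p. is_min_poly K x p \<and> rsquarefree (map_poly to_ac p))"

definition normal_ext :: "'a::field set \<Rightarrow> 'a set \<Rightarrow> bool" where
  "normal_ext K L \<longleftrightarrow> field_ext K L \<and>
     (\<forall>x\<in>L. \<exists>p. is_min_poly K x p \<and> (\<exists>rs. set rs \<subseteq> L \<and> p = (\<Prod>r\<leftarrow>rs. [:- r, 1:])))"

definition galois_ext :: "'a::field set \<Rightarrow> 'a set \<Rightarrow> bool" where
  "galois_ext K L \<longleftrightarrow> normal_ext K L \<and> separable_ext K L"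

definition galois_closure :: "'a::field set \<Rightarrow> 'a set \<Rightarrow> 'a set \<Rightarrow> bool" where
  "galois_closure K L N \<longleftrightarrow> galois_ext K N \<and> L \<subseteq> N \<and>
     (\<forall>M. galois_ext K M \<and> L \<subseteq> M \<and> M \<subseteq> N \<longrightarrow> M = N)"

text \<open>
  \<open>Gal N K\<close> is the set of automorphisms of \<open>N\<close> over \<open>K\<close>; extensionality only fixes their
  irrelevant values outside \<open>N\<close>.
\<close>

definition Gal :: "'a::field set \<Rightarrow> 'a set \<Rightarrow> ('a \<Rightarrow> 'a) set" where
  "Gal N K = {\<sigma> \<in> extensional N.
     \<sigma> \<in> ring_iso (sub_struct N) (sub_struct N) \<and> (\<forall>x\<in>K. \<sigma> x = x)}"

definition compositum :: "'a::field set \<Rightarrow> 'a set \<Rightarrow> 'a set" where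
  "compositum L L' = generate_field amb (L \<union> L')"


section \<open>Local fields\<close>

text \<open>
  Discrete valuations are normalised, i.e. surjective onto the integers. The value of the function
  at 0 (mathematically \<open>\<infinity>\<close>) and outside \<open>K\<close> is never used.
\<close>

definition discrete_valuation :: "'a::field set \<Rightarrow> ('a \<Rightarrow> int) \<Rightarrow> bool" where
  "discrete_valuation K v \<longleftrightarrow>
     (\<forall>x\<in>K - {0}. \<forall>y\<in>K - {0}. v (x * y) = v x + v y) \<and>
     (\<forall>x\<in>K - {0}. \<forall>y\<in>K - {0}. x + y \<noteq> 0 \<longrightarrow> min (v x) (v y) \<le> v (x + y)) \<and>
     v ` (K - {0}) = UNIV"

text \<open>The metric of the absolute value \<open>2 powi (- v x)\<close> on \<open>K\<close>.\<close>

definition val_dist :: "'a::field set \<Rightarrow> ('a \<Rightarrow> int) \<Rightarrow> 'a \<Rightarrow> 'a \<Rightarrow> real" where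
  "val_dist K v x y = (if x \<in> K \<and> y \<in> K \<and> x \<noteq> y then 2 powi (- v (x - y)) else 0)"

definition val_ring :: "'a::field set \<Rightarrow> ('a \<Rightarrow> int) \<Rightarrow> 'a set" where
  "val_ring K v = {x \<in> K. x = 0 \<or> 0 \<le> v x}"

definition val_ideal :: "'a::field set \<Rightarrow> ('a \<Rightarrow> int) \<Rightarrow> 'a set" where
  "val_ideal K v = {x \<in> K. x = 0 \<or> 0 < v x}"

definition residue_field :: "'a::field set \<Rightarrow> ('a \<Rightarrow> int) \<Rightarrow> 'a set ring" where
  "residue_field K v = sub_struct (val_ring K v) Quot val_ideal K v"

definition local_field :: "'a::field set \<Rightarrow> ('a \<Rightarrow> int) \<Rightarrow> bool" where
  "local_field K v \<longleftrightarrow> subfield K amb \<and> discrete_valuation K v \<and>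
     Metric_space.mcomplete K (val_dist K v) \<and> finite (carrier (residue_field K v))"

text \<open>\<open>w\<close> extends \<open>v\<close> (up to normalisation), with ramification index \<open>e\<close>.\<close>

definition val_over :: "'a::field set \<Rightarrow> ('a \<Rightarrow> int) \<Rightarrow> ('a \<Rightarrow> int) \<Rightarrow> nat \<Rightarrow> bool" where
  "val_over K v w e \<longleftrightarrow> 0 < e \<and> (\<forall>x\<in>K - {0}. w x = int e * v x)"

text \<open>
  If \<open>K\<close> is complete for \<open>v\<close>, then a finite extension \<open>L\<close> carries exactly one normalised
  discrete valuation above \<open>v\<close>, so the existential quantifier just names it:
  the condition is that its ramification index is the degree.
\<close>

definition totally_ramified :: "'a::field set \<Rightarrow> ('a \<Rightarrow> int) \<Rightarrow> 'a set \<Rightarrow> bool" where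
  "totally_ramified K v L \<longleftrightarrow> finite_ext K L \<and>
     (\<exists>w. discrete_valuation L w \<and> val_over K v w (ext_degree K L))"

text \<open>Here \<open>N\<close> is meant to be the Galois closure of \<open>L\<close> over \<open>K\<close>.\<close>

definition exceptional :: "'a::field set \<Rightarrow> ('a \<Rightarrow> int) \<Rightarrow> 'a set \<Rightarrow> 'a set \<Rightarrow> bool" where
  "exceptional K v L N \<longleftrightarrow> totally_ramified K v L \<and>
     (\<forall>\<sigma> \<in> Gal N K - Gal N L. \<not> totally_ramified K v (compositum L (\<sigma> ` L)))"


section \<open>Well-definedness of the metric\<close>

lemma subfield_ambD:
  assumes "subfield K (amb :: 'a::field ring)"
  shows "1 \<in> K" "x \<in> K \<Longrightarrow> - x \<in> K" "x \<in> K \<Longrightarrow> y \<in> K \<Longrightarrow> x - y \<in> K"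
proof -
  interpret F: Ring.field "amb :: 'a ring"
    by (rule field_from_type_algebra)
  have sr: "subring K (amb :: 'a ring)"
    using assms subfieldE(1) subcring.axioms(1) by blast
  have minus: "\<ominus>\<^bsub>amb\<^esub> x = - x" for x :: 'a
    by (rule F.minus_equality) (auto simp: ring_of_type_algebra_def)
  show "1 \<in> K"
    using subringE(3)[OF sr] by (simp add: ring_of_type_algebra_def)
  show m: "- x \<in> K" if "x \<in> K" for x
    using subringE(5)[OF sr that] minus by simp
  have "x + y \<in> K" if "x \<in> K" "y \<in> K" for x y
    using subringE(7)[OF sr that] by (simp add: ring_of_type_algebra_def)
  from this[OF _ m] show "x - y \<in> K" if "x \<in> K" "y \<in> K" for x y
    using that by (metis diff_conv_add_uminus)
qed

lemma Metric_space_val_dist: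
  assumes K: "subfield K (amb :: 'a::field ring)" and v: "discrete_valuation K v"
  shows "Metric_space K (val_dist K v)"
proof -
  note [simp] = subfield_ambD[OF K]
  have mult: "v (x * y) = v x + v y" if "x \<in> K" "y \<in> K" "x \<noteq> 0" "y \<noteq> 0" for x y
    using v that by (auto simp: discrete_valuation_def)
  have add: "min (v x) (v y) \<le> v (x + y)"
    if "x \<in> K" "y \<in> K" "x \<noteq> 0" "y \<noteq> 0" "x + y \<noteq> 0" for x y
    using v that by (auto simp: discrete_valuation_def)
  have "v (-1) = 0"
    using mult[of 1 1] mult[of "-1" "-1"] by simp
  then have neg: "v (- x) = v x" if "x \<in> K" "x \<noteq> 0" for x
    using mult[of "-1" x] that by simp
  show ?thesis
  proof
    show "0 \<le> val_dist K v x y" for x y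
      by (auto simp: val_dist_def)
    show "val_dist K v x y = val_dist K v y x" for x y
      using neg[of "x - y"] by (auto simp: val_dist_def)
    show "val_dist K v x y = 0 \<longleftrightarrow> x = y" if "x \<in> K" "y \<in> K" for x y
      using that by (auto simp: val_dist_def)
    show "val_dist K v x z \<le> val_dist K v x y + val_dist K v y z"
      if xyz: "x \<in> K" "y \<in> K" "z \<in> K" for x y z
    proof (cases "x = y \<or> y = z \<or> x = z")
      case True
      then show ?thesis by (auto simp: val_dist_def)
    next
      case False
      then have "min (v (x - y)) (v (y - z)) \<le> v (x - z)"
        using add[of "x - y" "y - z"] xyz by auto
      then have "v (x - y) \<le> v (x - z) \<or> v (y - z) \<le> v (x - z)"
        by auto
      then have "(2::real) powi (- v (x - z)) \<le> 2 powi (- v (x - y)) \<or>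
                 (2::real) powi (- v (x - z)) \<le> 2 powi (- v (y - z))"
        by (auto intro: power_int_increasing)
      moreover have "(0::real) \<le> 2 powi (- v (x - y))" "(0::real) \<le> 2 powi (- v (y - z))"
        by auto
      ultimately have "(2::real) powi (- v (x - z)) \<le> 2 powi (- v (x - y)) + 2 powi (- v (y - z))"
        by linarith
      then show ?thesis
        using False xyz by (simp add: val_dist_def)
    qed
  qed
qed

end

theory Submission
  imports Defs
begin

text \<open>
  A tame totally ramified extension of degree \<open>n\<close> is radical: taking an \<open>n\<close>-th root of a
  principal unit turns any uniformizer into some \<open>\<theta>\<close> with \<open>\<theta> ^ n \<in> K\<close>, and an automorphism of
  \<open>N\<close> over \<open>K\<close> is determined on \<open>L = K(\<theta>)\<close> by the root of unity \<open>\<sigma> \<theta> / \<theta>\<close>. Moreover, a totally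
  ramified extension contains no roots of unity of order prime to the residue characteristic
  besides those of \<open>K\<close>. If \<open>K\<close> has no nontrivial \<open>n\<close>-th root of unity, then no nontrivial
  \<open>\<sigma> \<theta> / \<theta>\<close> can lie in a totally ramified compositum; otherwise \<open>\<theta> \<mapsto> \<zeta> * \<theta>\<close> extends to an
  automorphism preserving \<open>L\<close>, and a power of \<open>\<theta>\<close> generates a Kummer subextension. Conversely, a
  Galois subextension \<open>M\<close> of degree \<open>k > 1\<close> is itself tame and totally ramified, hence contains
  two different \<open>k\<close>-th roots of the same element of \<open>K\<close>. Finally, the \<open>n\<close>-th roots of unity of
  \<open>K\<close> are the lifts of those of the residue field, whose unit group is cyclic of order \<open>q - 1\<close>.
\<close>

section \<open>Subfields of the ambient field\<close>

text \<open>Two mechanisms carry everything. The first is the absence of cancellation: in a totally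
  ramified extension of degree \<open>m\<close>, elements of values \<open>0\<close>, ...,
  \<open>m - 1\<close> have multiples over \<open>K\<close> of pairwise different values. Hence they
  form a basis, the polynomial \<open>X ^ m - \<theta> ^ m\<close> is minimal, completeness can be
  checked on coordinates, the residue field does not grow, and subextensions are again totally
  ramified. The second is tameness: \<open>gcd n q = 1\<close> makes \<open>n\<close> nonzero in the
  residue field, so that in a complete field raising to the \<open>n\<close>-th power is bijective
  on principal units. Every transfer of roots of unity between the residue field, \<open>K\<close>
  and a totally ramified extension rests on this. The obstacle is the automorphism with
  \<open>\<theta> \<mapsto> \<zeta> * \<theta>\<close>, which has to be defined on all of
  \<open>N\<close>. It is obtained by extending a partial embedding with Zorn's lemma; graphs are
  used for partial maps so that the upper bound of a chain is simply its union.\<close>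

lemma subring_amb_iff:
  "subring F (amb :: 'a::field ring) \<longleftrightarrow>
     1 \<in> F \<and> (\<forall>x\<in>F. - x \<in> F) \<and> (\<forall>x\<in>F. \<forall>y\<in>F. x + y \<in> F \<and> x * y \<in> F)"
proof -
  interpret A: Ring.field "amb :: 'a ring"
    by (rule field_from_type_algebra)
  have minus: "\<ominus>\<^bsub>amb\<^esub> x = - x" for x :: 'a
    by (rule A.minus_equality) (auto simp: ring_of_type_algebra_def)
  show ?thesis
  proof
    assume F: "subring F (amb :: 'a ring)"
    show "1 \<in> F \<and> (\<forall>x\<in>F. - x \<in> F) \<and> (\<forall>x\<in>F. \<forall>y\<in>F. x + y \<in> F \<and> x * y \<in> F)"
      using subringE(3,5,6,7)[OF F] minus by (auto simp: ring_of_type_algebra_def)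
  next
    assume F: "1 \<in> F \<and> (\<forall>x\<in>F. - x \<in> F) \<and> (\<forall>x\<in>F. \<forall>y\<in>F. x + y \<in> F \<and> x * y \<in> F)"
    show "subring F (amb :: 'a ring)"
      by (rule A.subringI) (use F minus in \<open>auto simp: ring_of_type_algebra_def\<close>)
  qed
qed

lemma subfield_amb_iff:
  "subfield F (amb :: 'a::field ring) \<longleftrightarrow>
     1 \<in> F \<and> (\<forall>x\<in>F. - x \<in> F) \<and> (\<forall>x\<in>F. \<forall>y\<in>F. x + y \<in> F \<and> x * y \<in> F) \<and>
     (\<forall>x\<in>F. inverse x \<in> F)"
proof -
  interpret A: Ring.field "amb :: 'a ring"
    by (rule field_from_type_algebra)
  have inv: "inv\<^bsub>amb\<^esub> x = inverse x" if "x \<noteq> 0" for x :: 'a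
    by (rule A.comm_inv_char) (use that in \<open>auto simp: ring_of_type_algebra_def\<close>)
  show ?thesis
  proof
    assume F: "subfield F (amb :: 'a ring)"
    then have F': "subring F (amb :: 'a ring)"
      by (rule subfieldE)
    have "inverse x \<in> F" if "x \<in> F" for x
    proof (cases "x = 0")
      case False
      then show ?thesis
        using A.subfield_m_inv(1)[OF F, of x] inv that by (auto simp: ring_of_type_algebra_def)
    qed (use that in auto)
    with F' show "1 \<in> F \<and> (\<forall>x\<in>F. - x \<in> F) \<and> (\<forall>x\<in>F. \<forall>y\<in>F. x + y \<in> F \<and> x * y \<in> F) \<and>
        (\<forall>x\<in>F. inverse x \<in> F)"
      by (auto simp: subring_amb_iff)
  next
    assume F: "1 \<in> F \<and> (\<forall>x\<in>F. - x \<in> F) \<and> (\<forall>x\<in>F. \<forall>y\<in>F. x + y \<in> F \<and> x * y \<in> F) \<and>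
        (\<forall>x\<in>F. inverse x \<in> F)"
    show "subfield F (amb :: 'a ring)"
    proof (rule A.subfieldI')
      show "subring F (amb :: 'a ring)"
        using F by (auto simp: subring_amb_iff)
    next
      fix k :: 'a assume "k \<in> F - {\<zero>\<^bsub>amb\<^esub>}"
      then show "inv\<^bsub>amb\<^esub> k \<in> F"
        using F inv by (auto simp: ring_of_type_algebra_def)
    qed
  qed
qed

locale subfld =
  fixes F :: "'a::field set"
  assumes subfield_amb: "subfield F amb"
begin

lemma one [simp, intro]: "1 \<in> F"
  and uminus [intro]: "x \<in> F \<Longrightarrow> - x \<in> F"
  and add [intro]: "x \<in> F \<Longrightarrow> y \<in> F \<Longrightarrow> x + y \<in> F"
  and mult [intro]: "x \<in> F \<Longrightarrow> y \<in> F \<Longrightarrow> x * y \<in> F"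
  and inverse [intro]: "x \<in> F \<Longrightarrow> inverse x \<in> F"
  using subfield_amb by (auto simp: subfield_amb_iff)

lemma zero [simp, intro]: "0 \<in> F"
  using add[OF one uminus[OF one]] by simp

lemma diff [intro]: "x \<in> F \<Longrightarrow> y \<in> F \<Longrightarrow> x - y \<in> F"
  using add[of x "- y"] uminus by simp

lemma divide [intro]: "x \<in> F \<Longrightarrow> y \<in> F \<Longrightarrow> x / y \<in> F"
  using mult[of x "inverse y"] inverse by (simp add: field_simps)

lemma power [intro]: "x \<in> F \<Longrightarrow> x ^ k \<in> F"
  by (induction k) auto

lemma power_int [intro]: "x \<in> F \<Longrightarrow> x powi k \<in> F"
  by (auto simp: power_int_def)

lemma sum [intro]: "(\<And>i. i \<in> A \<Longrightarrow> f i \<in> F) \<Longrightarrow> sum f A \<in> F"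
  by (induction A rule: infinite_finite_induct) auto

lemma of_nat [simp, intro]: "of_nat k \<in> F"
  by (induction k) auto

end

lemma field_extD:
  assumes "field_ext K L"
  shows "subfld K" "subfld L" "K \<subseteq> L"
  using assms by (auto simp: field_ext_def subfld_def)


section \<open>Polynomials over a subfield and minimal polynomials\<close>

lemma (in subfld) poly_in:
  assumes "poly_over F p" "x \<in> F"
  shows "poly p x \<in> F"
  unfolding poly_altdef using assms by (auto simp: poly_over_def)

lemma (in subfld) poly_over_simps [intro]:
  shows "poly_over F 0" "poly_over F 1" "c \<in> F \<Longrightarrow> poly_over F [:c:]"
    "poly_over F p \<Longrightarrow> poly_over F q \<Longrightarrow> poly_over F (p + q)"
    "poly_over F p \<Longrightarrow> poly_over F q \<Longrightarrow> poly_over F (p - q)"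
    "poly_over F p \<Longrightarrow> poly_over F q \<Longrightarrow> poly_over F (p * q)"
    "c \<in> F \<Longrightarrow> poly_over F p \<Longrightarrow> poly_over F (Polynomial.smult c p)"
    "c \<in> F \<Longrightarrow> poly_over F (Polynomial.monom c k)"
  by (auto simp: poly_over_def coeff_mult coeff_pCons split: nat.splits)

lemma is_min_polyD:
  assumes "is_min_poly K x p"
  shows "poly_over K p" "Polynomial.lead_coeff p = 1" "poly p x = 0" "p \<noteq> 0"
    "poly_over K g \<Longrightarrow> g \<noteq> 0 \<Longrightarrow> poly g x = 0 \<Longrightarrow> Polynomial.degree p \<le> Polynomial.degree g"
  using assms by (auto simp: is_min_poly_def)

lemma (in subfld) is_min_poly_unique:
  assumes p: "is_min_poly F x p" and q: "is_min_poly F x q"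
  shows "p = q"
proof (rule ccontr)
  assume "p \<noteq> q"
  note P = is_min_polyD[OF p] and Q = is_min_polyD[OF q]
  have deg: "Polynomial.degree p = Polynomial.degree q"
    using P(5)[OF Q(1,4,3)] Q(5)[OF P(1,4,3)] by simp
  have "Polynomial.degree p \<le> Polynomial.degree (p - q)"
    by (rule P(5)) (use P Q \<open>p \<noteq> q\<close> in auto)
  moreover have "Polynomial.degree (p - q) \<le> Polynomial.degree p"
    using deg degree_diff_le[of p "Polynomial.degree p" q] by simp
  ultimately have "Polynomial.coeff (p - q) (Polynomial.degree p) \<noteq> 0"
    using \<open>p \<noteq> q\<close> by (metis eq_iff_diff_eq_0 leading_coeff_0_iff le_antisym)
  then show False
    using P(2) Q(2) deg by simp
qed

lemma prod_list_root_iff: "poly (\<Prod>r\<leftarrow>rs. [:- r, 1:]) x = 0 \<longleftrightarrow> x \<in> set rs"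
  for x :: "'a::field"
  by (induction rs) auto

text \<open>Supplies the image of a new element when an embedding is extended: the polynomial that
  the image must satisfy divides one that splits in \<open>N\<close>. In the induction, a factor
  whose root is not a root of \<open>f\<close> divides the cofactor and can be cancelled.\<close>

lemma divisor_of_linear_factors_has_root:
  fixes f :: "'a::field poly"
  assumes "f dvd (\<Prod>r\<leftarrow>rs. [:- r, 1:])" "Polynomial.degree f > 0"
  shows "\<exists>r\<in>set rs. poly f r = 0"
  using assms
proof (induction rs)
  case Nil
  then show ?case by (auto elim!: is_unit_polyE)
next
  case (Cons r rs)
  show ?case
  proof (cases "poly f r = 0")
    case False
    obtain g where g: "(\<Prod>r\<leftarrow>r # rs. [:- r, 1:]) = f * g"
      using Cons.prems by (elim dvdE)
    have "poly (\<Prod>r\<leftarrow>r # rs. [:- r, 1:]) r = 0"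
      by simp
    with g False have "poly g r = 0"
      by simp
    then obtain h where h: "g = [:- r, 1:] * h"
      by (auto simp: poly_eq_0_iff_dvd)
    have "[:- r, 1:] * (\<Prod>r\<leftarrow>rs. [:- r, 1:]) = [:- r, 1:] * (f * h)"
      using g h by (simp only: list.map prod_list.Cons mult_ac)
    then have "(\<Prod>r\<leftarrow>rs. [:- r, 1:]) = f * h"
      by (subst (asm) mult_cancel_left) auto
    then show ?thesis
      using Cons by auto
  qed auto
qed

text \<open>The minimal polynomial of \<open>x\<close> exhibits \<open>inverse x\<close> as a polynomial in \<open>x\<close> over \<open>K\<close>.\<close>

lemma inverse_in_algebraic_subring:
  fixes K R :: "'a::field set"
  assumes K: "subfld K" and "K \<subseteq> R"
    and R: "\<And>x y. x \<in> R \<Longrightarrow> y \<in> R \<Longrightarrow> x + y \<in> R" "\<And>x y. x \<in> R \<Longrightarrow> y \<in> R \<Longrightarrow> x * y \<in> R"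
    and p: "is_min_poly K x p" and x: "x \<in> R"
  shows "inverse x \<in> R"
proof (cases "x = 0")
  case False
  interpret K: subfld K by fact
  note P = is_min_polyD[OF p]
  obtain c q where pq: "p = pCons c q"
    by (cases p)
  have q: "poly_over K q"
    using P(1) unfolding pq poly_over_def by (metis coeff_pCons_Suc)
  have c: "c \<in> K"
    using P(1) unfolding pq poly_over_def by (metis coeff_pCons_0)
  \<comment> \<open>A vanishing constant term would leave \<open>q\<close> as an annihilating
    polynomial of smaller degree.\<close>
  have "c \<noteq> 0"
  proof
    assume "c = 0"
    then have "poly q x = 0" "q \<noteq> 0"
      using P(3,4) False pq by auto
    from P(5)[OF q this(2,1)] show False
      using \<open>q \<noteq> 0\<close> pq by (simp add: degree_pCons_eq)
  qed
  have pow: "x ^ k \<in> R" for k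
    by (induction k) (use x R K.one \<open>K \<subseteq> R\<close> in auto)
  have qx: "poly q x \<in> R"
  proof -
    have "(\<Sum>i\<in>A. Polynomial.coeff q i * x ^ i) \<in> R" for A
      by (induction A rule: infinite_finite_induct)
        (use q pow R K.zero \<open>K \<subseteq> R\<close> in \<open>auto simp: poly_over_def intro!: R\<close>)
    then show ?thesis
      by (simp add: poly_altdef)
  qed
  have "c + x * poly q x = 0"
    using P(3) pq by simp
  then have "x * poly q x = - c"
    by (simp add: eq_neg_iff_add_eq_0 add.commute)
  then have "inverse x = (- inverse c) * poly q x"
    using False \<open>c \<noteq> 0\<close> by (simp add: field_simps)
  moreover have "- inverse c \<in> R"
    using K.uminus[OF K.inverse[OF c]] \<open>K \<subseteq> R\<close> by auto
  ultimately show ?thesis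
    using R(2)[of "- inverse c" "poly q x"] qx by simp
qed (use x in auto)


section \<open>Extension of embeddings\<close>

text \<open>
  A partial embedding of \<open>N\<close> into itself over \<open>K\<close> is encoded by its graph, which is a subring
  of \<open>N \<times> N\<close>; since \<open>N\<close> is algebraic over \<open>K\<close>, its domain is then automatically a field.
\<close>

definition embedding_graph :: "'a::field set \<Rightarrow> 'a set \<Rightarrow> ('a \<times> 'a) set \<Rightarrow> bool" where
  "embedding_graph K N S \<longleftrightarrow> S \<subseteq> N \<times> N \<and> (\<forall>k\<in>K. (k, k) \<in> S) \<and>
     (\<forall>a b c d. (a, b) \<in> S \<and> (c, d) \<in> S \<longrightarrow> (a + c, b + d) \<in> S \<and> (a * c, b * d) \<in> S) \<and>
     (\<forall>b. (0, b) \<in> S \<longrightarrow> b = 0)"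

text \<open>The action of a partial embedding on polynomials, kept as a relation so that no function
  has to be extracted from its graph.\<close>

definition poly_rel :: "('a::field \<times> 'a) set \<Rightarrow> 'a poly \<Rightarrow> 'a poly \<Rightarrow> bool" where
  "poly_rel S p q \<longleftrightarrow> (\<forall>i. (Polynomial.coeff p i, Polynomial.coeff q i) \<in> S)"

lemma poly_rel_Id_on: "poly_rel (Id_on K) p q \<longleftrightarrow> p = q \<and> poly_over K p"
  by (auto simp: poly_rel_def poly_over_def poly_eq_iff Id_on_def)

lemma degree_less_if_coeff_0:
  fixes p :: "'a::zero poly"
  assumes "Polynomial.degree p \<le> n" "Polynomial.coeff p n = 0" "p \<noteq> 0"
  shows "Polynomial.degree p < n"
  using assms by (metis leading_coeff_0_iff order_le_less)

locale embedding_graph_loc = K: subfld K + N: subfld N for K N :: "'a::field set" +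
  fixes S :: "('a \<times> 'a) set"
  assumes K_sub_N: "K \<subseteq> N" and graph: "embedding_graph K N S"
begin

lemma in_N: "(a, b) \<in> S \<Longrightarrow> a \<in> N" "(a, b) \<in> S \<Longrightarrow> b \<in> N"
  and base [simp]: "k \<in> K \<Longrightarrow> (k, k) \<in> S"
  and add: "(a, b) \<in> S \<Longrightarrow> (c, d) \<in> S \<Longrightarrow> (a + c, b + d) \<in> S"
  and mult: "(a, b) \<in> S \<Longrightarrow> (c, d) \<in> S \<Longrightarrow> (a * c, b * d) \<in> S"
  and kernel: "(0, b) \<in> S \<Longrightarrow> b = 0"
  using graph by (auto simp: embedding_graph_def)

lemma diff: "(a, b) \<in> S \<Longrightarrow> (c, d) \<in> S \<Longrightarrow> (a - c, b - d) \<in> S"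
  using add[of a b "- c" "- d"] mult[of "-1" "-1" c d] base[of "-1"] K.uminus[OF K.one] by auto

lemma sum: "(\<And>i. i \<in> A \<Longrightarrow> (f i, g i) \<in> S) \<Longrightarrow> (sum f A, sum g A) \<in> S"
  by (induction A rule: infinite_finite_induct) (auto intro: add)

lemma single_valued: "(a, b) \<in> S \<Longrightarrow> (a, c) \<in> S \<Longrightarrow> b = c"
  using diff[of a b a c] kernel[of "b - c"] by simp

lemma poly_rel_add: "poly_rel S p q \<Longrightarrow> poly_rel S p' q' \<Longrightarrow> poly_rel S (p + p') (q + q')"
  by (auto simp: poly_rel_def intro: add)

lemma poly_rel_diff: "poly_rel S p q \<Longrightarrow> poly_rel S p' q' \<Longrightarrow> poly_rel S (p - p') (q - q')"
  by (auto simp: poly_rel_def intro: diff)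

lemma poly_rel_mult: "poly_rel S p q \<Longrightarrow> poly_rel S p' q' \<Longrightarrow> poly_rel S (p * p') (q * q')"
  by (auto simp: poly_rel_def coeff_mult intro!: sum mult)

lemma poly_rel_monom: "(a, b) \<in> S \<Longrightarrow> poly_rel S (Polynomial.monom a k) (Polynomial.monom b k)"
  by (auto simp: poly_rel_def)

lemma poly_rel_const: "(a, b) \<in> S \<Longrightarrow> poly_rel S [:a:] [:b:]"
  using poly_rel_monom[of a b 0] by (simp add: monom_0)

lemma poly_rel_refl: "poly_over K p \<Longrightarrow> poly_rel S p p"
  by (auto simp: poly_rel_def poly_over_def)

lemma poly_rel_zero: "poly_rel S 0 q \<Longrightarrow> q = 0"
  by (auto simp: poly_rel_def poly_eq_iff intro: kernel)

text \<open>Long division is run on both sides at once. Because \<open>f\<close> is monic, each step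
  uses only ring operations, which \<open>S\<close> respects; on the second side the coefficient is
  read off at the degree of \<open>a\<close>, whatever the degree of \<open>a'\<close> is.\<close>

lemma poly_rel_division:
  assumes f: "poly_rel S f f'" "Polynomial.lead_coeff f = 1" and a: "poly_rel S a a'"
  shows "\<exists>q q' r r'. poly_rel S q q' \<and> poly_rel S r r' \<and> a = q * f + r \<and> a' = q' * f' + r' \<and>
           (r = 0 \<or> Polynomial.degree r < Polynomial.degree f)"
  using a
proof (induction "Polynomial.degree a" arbitrary: a a' rule: less_induct)
  case less
  show ?case
  proof (cases "a = 0 \<or> Polynomial.degree a < Polynomial.degree f")
    case True
    have "poly_rel S 0 0"
      by (auto simp: poly_rel_def)
    then show ?thesis
      using True less.prems by (intro exI[of _ 0] exI[of _ a] exI[of _ a']) auto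
  next
    case False
    let ?n = "Polynomial.degree a" and ?m = "Polynomial.degree f"
    define t where "t = Polynomial.monom (Polynomial.lead_coeff a) (?n - ?m)"
    define t' where "t' = Polynomial.monom (Polynomial.coeff a' ?n) (?n - ?m)"
    define b where "b = a - t * f"
    define b' where "b' = a' - t' * f'"
    have t: "poly_rel S t t'"
      unfolding t_def t'_def using less.prems by (intro poly_rel_monom) (auto simp: poly_rel_def)
    have b: "poly_rel S b b'"
      unfolding b_def b'_def by (intro poly_rel_diff poly_rel_mult less.prems t f)
    show ?thesis
    proof (cases "b = 0")
      case True
      then show ?thesis
        using t b by (intro exI[of _ t] exI[of _ t'] exI[of _ b] exI[of _ b'])
          (auto simp: b_def b'_def)
    next
      case b_nz: False
      have "Polynomial.degree (t * f) \<le> ?n"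
        using False degree_mult_le[of t f] degree_monom_le[of "Polynomial.lead_coeff a" "?n - ?m"]
        by (auto simp: t_def)
      then have "Polynomial.degree b \<le> ?n"
        unfolding b_def by (intro degree_diff_le) auto
      moreover have "Polynomial.coeff b ?n = 0"
        using False f(2) coeff_monom_mult[of "Polynomial.lead_coeff a" "?n - ?m" f ?n]
        by (simp add: b_def t_def)
      ultimately have "Polynomial.degree b < ?n"
        using b_nz by (intro degree_less_if_coeff_0)
      from less.hyps[OF this b] obtain q q' r r' where
        *: "poly_rel S q q'" "poly_rel S r r'" "b = q * f + r" "b' = q' * f' + r'"
           "r = 0 \<or> Polynomial.degree r < ?m"
        by blast
      have "a = (q + t) * f + r" "a' = (q' + t') * f' + r'"
        using *(3,4) by (auto simp: b_def b'_def algebra_simps)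
      then show ?thesis
        using poly_rel_add[OF *(1) t] *(2,5) by blast
    qed
  qed
qed

text \<open>Here \<open>f\<close> is the minimal polynomial of \<open>x\<close> over the domain of
  \<open>S\<close>, and \<open>f'\<close> is its image under the embedding.\<close>

definition minimal_rel :: "'a \<Rightarrow> 'a poly \<Rightarrow> 'a poly \<Rightarrow> bool" where
  "minimal_rel x f f' \<longleftrightarrow> poly_rel S f f' \<and> Polynomial.lead_coeff f = 1 \<and> poly f x = 0 \<and>
     (\<forall>g g'. poly_rel S g g' \<and> g \<noteq> 0 \<and> poly g x = 0 \<longrightarrow>
        Polynomial.degree f \<le> Polynomial.degree g)"

text \<open>Minimality kills the remainder on the domain side, and its partner vanishes with it;
  this is how divisibility crosses to the image side.\<close>

lemma minimal_rel_dvd: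
  assumes f: "minimal_rel x f f'" and a: "poly_rel S a a'" "poly a x = 0"
  shows "f' dvd a'"
proof -
  obtain q q' r r' where *: "poly_rel S q q'" "poly_rel S r r'" "a = q * f + r" "a' = q' * f' + r'"
      "r = 0 \<or> Polynomial.degree r < Polynomial.degree f"
    using poly_rel_division[of f f' a a'] f a(1) by (auto simp: minimal_rel_def)
  have "poly r x = 0"
    using *(3) a(2) f by (simp add: minimal_rel_def)
  then have "r = 0"
    using *(2,5) f unfolding minimal_rel_def by (meson not_less)
  then show ?thesis
    using *(2,4) poly_rel_zero by auto
qed

text \<open>The new graph is that of \<open>poly a x \<mapsto> poly b y\<close>. It is well defined
  because \<open>poly a x = 0\<close> makes \<open>f'\<close> divide \<open>b\<close>, so that
  \<open>y\<close>, a root of \<open>f'\<close>, is a root of \<open>b\<close>.\<close>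

lemma extend:
  assumes f: "minimal_rel x f f'" and x: "x \<in> N" and y: "y \<in> N" "poly f' y = 0"
  shows "embedding_graph K N {(poly a x, poly b y) |a b. poly_rel S a b}"
    and "S \<subseteq> {(poly a x, poly b y) |a b. poly_rel S a b}"
    and "(x, y) \<in> {(poly a x, poly b y) |a b. poly_rel S a b}"
proof -
  let ?S = "{(poly a x, poly b y) |a b. poly_rel S a b}"
  show "S \<subseteq> ?S"
  proof safe
    fix a b assume "(a, b) \<in> S"
    then show "\<exists>p q. (a, b) = (poly p x, poly q y) \<and> poly_rel S p q"
      by (intro exI[of _ "[:a:]"] exI[of _ "[:b:]"]) (auto intro: poly_rel_const)
  qed
  have "poly_rel S [:0, 1:] [:0, 1:]"
    by (rule poly_rel_refl) (auto simp: poly_over_def coeff_pCons split: nat.splits)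
  then show "(x, y) \<in> ?S"
    by (intro CollectI exI[of _ "[:0, 1:]"]) auto
  have "poly_over N a" "poly_over N b" if "poly_rel S a b" for a b
    using that by (auto simp: poly_over_def poly_rel_def dest: in_N)
  then have "?S \<subseteq> N \<times> N"
    using x y N.poly_in by blast
  moreover have "\<forall>k\<in>K. (k, k) \<in> ?S"
    using \<open>S \<subseteq> ?S\<close> base by blast
  moreover have "(a + c, b + d) \<in> ?S \<and> (a * c, b * d) \<in> ?S"
    if "(a, b) \<in> ?S" "(c, d) \<in> ?S" for a b c d
  proof -
    from that obtain p q p' q' where "poly_rel S p q" "poly_rel S p' q'"
      "a = poly p x" "b = poly q y" "c = poly p' x" "d = poly q' y" by auto
    then have "poly_rel S (p + p') (q + q')" "poly_rel S (p * p') (q * q')"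
      and "a + c = poly (p + p') x" "b + d = poly (q + q') y"
        "a * c = poly (p * p') x" "b * d = poly (q * q') y"
      by (simp_all add: poly_rel_add poly_rel_mult)
    then show ?thesis
      by blast
  qed
  moreover have "b = 0" if "(0, b) \<in> ?S" for b
  proof -
    from that obtain p q where pq: "poly_rel S p q" "poly p x = 0" "b = poly q y"
      by auto
    from minimal_rel_dvd[OF f pq(1,2)] show ?thesis
      using y(2) pq(3) by (auto elim!: dvdE)
  qed
  ultimately show "embedding_graph K N ?S"
    unfolding embedding_graph_def by blast
qed

end

section \<open>Automorphisms of a normal extension with a prescribed value\<close>

locale normal_extension = K: subfld K + N: subfld N for K N :: "'a::field set" +
  assumes normal: "normal_ext K N"
begin

lemma K_sub_N: "K \<subseteq> N"
  using normal by (auto simp: normal_ext_def field_ext_def)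

lemma min_poly_splits:
  assumes "is_min_poly K x p" "x \<in> N"
  obtains rs where "set rs \<subseteq> N" "p = (\<Prod>r\<leftarrow>rs. [:- r, 1:])"
  using assms normal K.is_min_poly_unique by (metis normal_ext_def)

lemma embedding_graph_locI: "embedding_graph K N S \<Longrightarrow> embedding_graph_loc K N S"
  by unfold_locales (use K_sub_N in auto)

lemma domain_inverse:
  assumes S: "embedding_graph K N S" and a: "a \<in> Domain S"
  shows "inverse a \<in> Domain S"
proof -
  interpret S: embedding_graph_loc K N S
    using S by (rule embedding_graph_locI)
  have "a \<in> N"
    using a S.in_N by auto
  then obtain p where p: "is_min_poly K a p"
    using normal by (auto simp: normal_ext_def)
  show ?thesis
  proof (rule inverse_in_algebraic_subring[OF K.subfld_axioms _ _ _ p a])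
    show "K \<subseteq> Domain S"
      using S.base by blast
  qed (use S.add S.mult in blast)+
qed

text \<open>An annihilating polynomial of least degree is made monic; this is the place where the
  domain has to be closed under inverses.\<close>

lemma minimal_rel_exists:
  assumes S: "embedding_graph K N S" and x: "x \<in> N"
  shows "\<exists>f f'. embedding_graph_loc.minimal_rel S x f f'"
proof -
  interpret S: embedding_graph_loc K N S
    using S by (rule embedding_graph_locI)
  obtain p where p: "is_min_poly K x p"
    using normal x by (auto simp: normal_ext_def)
  let ?P = "\<lambda>g. (\<exists>g'. poly_rel S g g') \<and> g \<noteq> 0 \<and> poly g x = 0"
  have "?P p"
    using is_min_polyD[OF p] S.poly_rel_refl by auto
  from ex_has_least_nat[of ?P, OF this, of Polynomial.degree]
  obtain g g' where g: "poly_rel S g g'" "g \<noteq> 0" "poly g x = 0"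
    and min: "\<And>h. ?P h \<Longrightarrow> Polynomial.degree g \<le> Polynomial.degree h"
    by blast
  have "Polynomial.lead_coeff g \<in> Domain S"
    using g(1) by (auto simp: poly_rel_def)
  from domain_inverse[OF S this] obtain c where
    c: "(inverse (Polynomial.lead_coeff g), c) \<in> S" by blast
  have "S.minimal_rel x ([:inverse (Polynomial.lead_coeff g):] * g) ([:c:] * g')"
    unfolding S.minimal_rel_def using g min c
    by (auto intro: S.poly_rel_mult[OF S.poly_rel_const, simplified])
  then show ?thesis
    by blast
qed

text \<open>A maximal graph is total: for any \<open>x\<close> in \<open>N\<close>, the transported
  minimal polynomial has a root in \<open>N\<close> by normality, and \<open>extend\<close> would
  enlarge the graph.\<close>

lemma embedding_extends:
  assumes S0: "embedding_graph K N S0"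
  obtains S where "S0 \<subseteq> S" "embedding_graph K N S" "Domain S = N"
proof -
  define A where "A = {S. embedding_graph K N S \<and> S0 \<subseteq> S}"
  have "\<exists>S\<in>A. \<forall>T\<in>A. S \<subseteq> T \<longrightarrow> T = S"
  proof (rule subset_Zorn_nonempty)
    show "A \<noteq> {}"
      using S0 by (auto simp: A_def)
    fix C assume C: "C \<noteq> {}" "subset.chain A C"
    then obtain S1 where S1: "S1 \<in> C" by blast
    have CA: "S \<in> C \<Longrightarrow> embedding_graph K N S \<and> S0 \<subseteq> S" for S
      using C by (auto simp: A_def subset.chain_def)
    have "(a + c, b + d) \<in> \<Union>C \<and> (a * c, b * d) \<in> \<Union>C"
      if "(a, b) \<in> \<Union>C" "(c, d) \<in> \<Union>C" for a b c d
    proof -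
      from that obtain S T where ST: "S \<in> C" "T \<in> C" "(a, b) \<in> S" "(c, d) \<in> T"
        by blast
      then have "S \<subseteq> T \<or> T \<subseteq> S"
        using C(2) by (auto simp: subset.chain_def)
      with ST obtain U where "U \<in> C" "(a, b) \<in> U" "(c, d) \<in> U"
        by blast
      then show ?thesis
        using CA[of U] unfolding embedding_graph_def by blast
    qed
    moreover have "\<forall>k\<in>K. (k, k) \<in> \<Union>C"
      using CA[OF S1] S1 by (auto simp: embedding_graph_def)
    moreover have "\<Union>C \<subseteq> N \<times> N" "\<forall>b. (0, b) \<in> \<Union>C \<longrightarrow> b = 0"
      using CA unfolding embedding_graph_def by blast+
    ultimately have "embedding_graph K N (\<Union>C)"
      unfolding embedding_graph_def by blast
    then show "\<Union>C \<in> A"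
      using CA[OF S1] S1 by (auto simp: A_def)
  qed
  then obtain S where S: "embedding_graph K N S" "S0 \<subseteq> S"
    and max: "\<And>T. embedding_graph K N T \<Longrightarrow> S \<subseteq> T \<Longrightarrow> T = S"
    unfolding A_def by (metis (mono_tags, lifting) mem_Collect_eq order_trans)
  interpret S: embedding_graph_loc K N S
    using S(1) by (rule embedding_graph_locI)
  have "x \<in> Domain S" if x: "x \<in> N" for x
  proof -
    obtain f f' where f: "S.minimal_rel x f f'"
      using minimal_rel_exists[OF S(1) x] by blast
    then have f1: "poly_rel S f f'" "Polynomial.lead_coeff f = 1" "poly f x = 0"
      by (auto simp: S.minimal_rel_def)
    obtain p where p: "is_min_poly K x p"
      using normal x by (auto simp: normal_ext_def)
    obtain rs where rs: "set rs \<subseteq> N" "p = (\<Prod>r\<leftarrow>rs. [:- r, 1:])"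
      using min_poly_splits[OF p x] .
    \<comment> \<open>The coefficients of \<open>p\<close> lie in \<open>K\<close>, so
      \<open>p\<close> corresponds to itself under \<open>S\<close>.\<close>
    have "f' dvd p"
      using S.minimal_rel_dvd[OF f S.poly_rel_refl] is_min_polyD[OF p] by auto
    have "Polynomial.degree f > 0"
    proof (rule ccontr)
      assume "\<not> Polynomial.degree f > 0"
      then obtain c where "f = [:c:]"
        by (metis degree_eq_zeroE not_gr_zero)
      with f1 show False by auto
    qed
    \<comment> \<open>The leading 1 of \<open>f\<close> is sent to 1, so \<open>f'\<close> has at
      least the degree of \<open>f\<close> and is not constant.\<close>
    moreover have "(1, Polynomial.coeff f' (Polynomial.degree f)) \<in> S"
      using f1(1,2) unfolding poly_rel_def by metis
    then have "Polynomial.coeff f' (Polynomial.degree f) = 1"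
      using S.single_valued[OF S.base[OF K.one]] by auto
    then have "Polynomial.degree f \<le> Polynomial.degree f'"
      by (intro le_degree) auto
    ultimately have "Polynomial.degree f' > 0"
      by simp
    with \<open>f' dvd p\<close> obtain y where y: "y \<in> N" "poly f' y = 0"
      using divisor_of_linear_factors_has_root[of f' rs] rs by auto
    show ?thesis
      using max[OF S.extend(1,2)[OF f x y]] S.extend(3)[OF f x y] by blast
  qed
  then have "Domain S = N"
    using S.in_N by auto
  with S that show ?thesis by blast
qed

lemma total_embedding_graph_GalE:
  assumes S: "embedding_graph K N S" "Domain S = N"
  obtains \<sigma> where "\<sigma> \<in> Gal N K" "\<And>x. x \<in> N \<Longrightarrow> (x, \<sigma> x) \<in> S"
proof -
  interpret S: embedding_graph_loc K N S
    using S(1) by (rule embedding_graph_locI)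
  define \<sigma> where "\<sigma> = restrict (\<lambda>x. THE y. (x, y) \<in> S) N"
  have \<sigma>: "(x, \<sigma> x) \<in> S" if "x \<in> N" for x
  proof -
    have "\<exists>!y. (x, y) \<in> S"
      using that S(2) S.single_valued by blast
    from theI'[OF this] show ?thesis
      using that by (simp add: \<sigma>_def)
  qed
  have eq: "\<sigma> x = y" if "(x, y) \<in> S" for x y
    using \<sigma> S.single_valued S.in_N that by blast
  have add: "\<sigma> (x + y) = \<sigma> x + \<sigma> y" if "x \<in> N" "y \<in> N" for x y
    using S.add[OF \<sigma> \<sigma>] eq that by blast
  have mult: "\<sigma> (x * y) = \<sigma> x * \<sigma> y" if "x \<in> N" "y \<in> N" for x y
    using S.mult[OF \<sigma> \<sigma>] eq that by blast
  have fixes_K: "\<sigma> x = x" if "x \<in> K" for x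
    using eq S.base that by blast
  have in_N: "\<sigma> x \<in> N" if "x \<in> N" for x
    using \<sigma> S.in_N that by blast
  have inj: "inj_on \<sigma> N"
  proof (rule inj_onI)
    fix x y assume xy: "x \<in> N" "y \<in> N" "\<sigma> x = \<sigma> y"
    have "\<sigma> (x - y) = 0"
      using S.diff[OF \<sigma>[OF xy(1)] \<sigma>[OF xy(2)]] eq xy(3) by simp
    moreover have "\<sigma> (inverse (x - y)) * \<sigma> (x - y) = 1" if "x \<noteq> y"
      using mult[of "inverse (x - y)" "x - y"] fixes_K[of 1] that xy by (simp add: N.inverse N.diff)
    ultimately show "x = y" by force
  qed
  have poly_\<sigma>: "poly p (\<sigma> x) = \<sigma> (poly p x)" if "poly_over K p" "x \<in> N" for p x
  proof -
    have "(x ^ k, \<sigma> x ^ k) \<in> S" for k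
      by (induction k) (use \<sigma>[OF that(2)] S.mult in auto)
    then have "(poly p x, poly p (\<sigma> x)) \<in> S"
      unfolding poly_altdef using that by (intro S.sum S.mult S.base) (auto simp: poly_over_def)
    then show ?thesis
      using eq by metis
  qed
  \<comment> \<open>\<open>\<sigma>\<close> maps the finite set of roots in \<open>N\<close> of a
    minimal polynomial over \<open>K\<close> injectively into itself, hence onto itself.\<close>
  have surj: "\<sigma> ` N = N"
  proof
    show "\<sigma> ` N \<subseteq> N"
      using in_N by auto
    show "N \<subseteq> \<sigma> ` N"
    proof
      fix x assume x: "x \<in> N"
      obtain p where p: "is_min_poly K x p"
        using normal x by (auto simp: normal_ext_def)
      note P = is_min_polyD[OF p]
      define R where "R = {r \<in> N. poly p r = 0}"
      have "finite R"
        unfolding R_def using poly_roots_finite[OF P(4)] by (rule rev_finite_subset) auto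
      moreover have "\<sigma> ` R \<subseteq> R"
        using in_N poly_\<sigma>[OF P(1)] fixes_K[of 0] by (auto simp: R_def)
      moreover have "inj_on \<sigma> R"
        using inj by (rule inj_on_subset) (auto simp: R_def)
      ultimately have "\<sigma> ` R = R"
        by (rule endo_inj_surj)
      then show "x \<in> \<sigma> ` N"
        using x P(3) by (auto simp: R_def)
    qed
  qed
  have "\<sigma> \<in> Gal N K"
    unfolding Gal_def ring_iso_def ring_hom_def
    using in_N add mult fixes_K fixes_K[of 1] inj surj
    by (auto simp: ring_of_type_algebra_def bij_betw_def \<sigma>_def)
  with \<sigma> that show ?thesis by blast
qed

theorem conjugate_by_Gal:
  assumes x: "x \<in> N" and p: "is_min_poly K x p" and y: "y \<in> N" "poly p y = 0"
  obtains \<sigma> where "\<sigma> \<in> Gal N K" "\<sigma> x = y"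
proof -
  have "embedding_graph K N (Id_on K)"
    unfolding embedding_graph_def
  proof (intro conjI allI impI)
    show "Id_on K \<subseteq> N \<times> N"
      using K_sub_N by (simp add: Id_on_def subset_iff)
  next
    fix a b c d assume "(a, b) \<in> Id_on K \<and> (c, d) \<in> Id_on K"
    then have "b = a" "d = c" "a \<in> K" "c \<in> K"
      by auto
    then show "(a + c, b + d) \<in> Id_on K" "(a * c, b * d) \<in> Id_on K"
      by (simp_all add: Id_on_iff K.add K.mult)
  qed (simp_all add: Id_on_iff)
  then interpret S: embedding_graph_loc K N "Id_on K"
    by (rule embedding_graph_locI)
  \<comment> \<open>Over the graph of the identity of \<open>K\<close>, \<open>minimal_rel\<close>
    is the usual notion of minimal polynomial.\<close>
  have "S.minimal_rel x p p"
    using p by (auto simp: S.minimal_rel_def poly_rel_Id_on is_min_poly_def)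
  note ext = S.extend[OF this x y]
  obtain S where "{(poly a x, poly b y) |a b. poly_rel (Id_on K) a b} \<subseteq> S"
    and S: "embedding_graph K N S" "Domain S = N"
    using embedding_extends[OF ext(1)] .
  with ext(3) have xy: "(x, y) \<in> S" by blast
  obtain \<sigma> where \<sigma>: "\<sigma> \<in> Gal N K" "\<And>x. x \<in> N \<Longrightarrow> (x, \<sigma> x) \<in> S"
    using total_embedding_graph_GalE[OF S] by blast
  have "\<sigma> x = y"
    using embedding_graph_loc.single_valued[OF embedding_graph_locI[OF S(1)] \<sigma>(2)[OF x] xy] .
  with \<sigma>(1) that show ?thesis by blast
qed

end

lemma normal_extensionI: "normal_ext K N \<Longrightarrow> normal_extension K N"
  by (auto simp: normal_ext_def field_ext_def
      intro!: normal_extension.intro normal_extension_axioms.intro subfld.intro)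


section \<open>Automorphisms\<close>

lemma GalD:
  assumes "\<sigma> \<in> Gal N K"
  shows "x \<in> N \<Longrightarrow> \<sigma> x \<in> N" "x \<in> N \<Longrightarrow> y \<in> N \<Longrightarrow> \<sigma> (x + y) = \<sigma> x + \<sigma> y"
    "x \<in> N \<Longrightarrow> y \<in> N \<Longrightarrow> \<sigma> (x * y) = \<sigma> x * \<sigma> y" "x \<in> K \<Longrightarrow> \<sigma> x = x"
  using assms by (auto simp: Gal_def ring_iso_def ring_hom_def ring_of_type_algebra_def Pi_iff)

lemma Gal_mono: "\<sigma> \<in> Gal N K \<Longrightarrow> \<forall>x\<in>L. \<sigma> x = x \<Longrightarrow> \<sigma> \<in> Gal N L"
  by (auto simp: Gal_def)

locale galois_automorphism = K: subfld K + N: subfld N for K N :: "'a::field set" +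
  fixes \<sigma> :: "'a \<Rightarrow> 'a"
  assumes K_sub_N: "K \<subseteq> N" and Gal: "\<sigma> \<in> Gal N K"
begin

lemmas closed [intro] = GalD(1)[OF Gal]
  and add = GalD(2)[OF Gal]
  and mult = GalD(3)[OF Gal]
  and fixed [simp] = GalD(4)[OF Gal]

lemma power: "x \<in> N \<Longrightarrow> \<sigma> (x ^ k) = \<sigma> x ^ k"
  by (induction k) (auto simp: mult N.power)

lemma uminus: "x \<in> N \<Longrightarrow> \<sigma> (- x) = - \<sigma> x"
  using add[of x "- x"] by (simp add: eq_neg_iff_add_eq_0 add.commute N.uminus)

lemma inverse: "x \<in> N \<Longrightarrow> \<sigma> (inverse x) = inverse (\<sigma> x)"
  using mult[of x "inverse x"] by (cases "x = 0") (auto simp: N.inverse intro: inverse_unique[symmetric])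

lemma sum: "(\<And>i. i \<in> A \<Longrightarrow> f i \<in> N) \<Longrightarrow> \<sigma> (sum f A) = (\<Sum>i\<in>A. \<sigma> (f i))"
  by (induction A rule: infinite_finite_induct) (auto simp: add N.sum)

lemma poly:
  assumes "poly_over K p" "x \<in> N"
  shows "\<sigma> (poly p x) = poly p (\<sigma> x)"
  unfolding poly_altdef using assms K_sub_N
  by (subst sum) (auto simp: poly_over_def mult power N.power subset_iff intro!: sum.cong)

end

lemma (in normal_extension) galois_automorphismI: "\<sigma> \<in> Gal N K \<Longrightarrow> galois_automorphism K N \<sigma>"
  by unfold_locales (use K_sub_N in auto)

text \<open>The largest normal subextension of a subextension \<open>L\<close> of a Galois extension \<open>N\<close>.\<close>

lemma galois_ext_stable_core:
  assumes N: "galois_ext K N" and L: "subfield L amb" "K \<subseteq> L" "L \<subseteq> N"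
  defines "M \<equiv> {x \<in> L. \<forall>\<sigma>\<in>Gal N K. \<sigma> x \<in> L}"
  shows "subfield M amb" "K \<subseteq> M" "galois_ext K M"
proof -
  interpret normal_extension K N
    using N by (intro normal_extensionI) (simp add: galois_ext_def)
  interpret L: subfld L
    using L(1) by (rule subfld.intro)
  have hom: "\<sigma> (x + y) = \<sigma> x + \<sigma> y" "\<sigma> (x * y) = \<sigma> x * \<sigma> y" "\<sigma> (- x) = - \<sigma> x"
      "\<sigma> (inverse x) = inverse (\<sigma> x)" "k \<in> K \<Longrightarrow> \<sigma> k = k"
    if "\<sigma> \<in> Gal N K" "x \<in> L" "y \<in> L" for \<sigma> x y k
  proof -
    interpret \<sigma>: galois_automorphism K N \<sigma>
      using that by (intro galois_automorphismI)
    show "\<sigma> (x + y) = \<sigma> x + \<sigma> y" "\<sigma> (x * y) = \<sigma> x * \<sigma> y" "\<sigma> (- x) = - \<sigma> x"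
      "\<sigma> (inverse x) = inverse (\<sigma> x)" "k \<in> K \<Longrightarrow> \<sigma> k = k"
      using that L(3) by (auto intro!: \<sigma>.add \<sigma>.mult \<sigma>.uminus \<sigma>.inverse)
  qed
  show KM: "K \<subseteq> M"
  proof
    fix k assume k: "k \<in> K"
    then have "\<sigma> k \<in> L" if "\<sigma> \<in> Gal N K" for \<sigma>
      using hom(5)[OF that L.one L.one k] L(2) by auto
    with k L(2) show "k \<in> M"
      by (auto simp: M_def)
  qed
  show M: "subfield M amb"
    unfolding subfield_amb_iff
  proof (intro conjI ballI)
    show "1 \<in> M"
      using KM by auto
  next
    fix x assume "x \<in> M"
    then have x: "x \<in> L" "\<And>\<sigma>. \<sigma> \<in> Gal N K \<Longrightarrow> \<sigma> x \<in> L"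
      by (auto simp: M_def)
    from x(1) L.uminus[OF x(2)] L.inverse[OF x(2)] show "- x \<in> M" "inverse x \<in> M"
      by (auto simp: M_def hom(3,4))
    fix y assume "y \<in> M"
    then have y: "y \<in> L" "\<And>\<sigma>. \<sigma> \<in> Gal N K \<Longrightarrow> \<sigma> y \<in> L"
      by (auto simp: M_def)
    from x(1) y(1) L.add[OF x(2) y(2)] L.mult[OF x(2) y(2)] show "x + y \<in> M" "x * y \<in> M"
      by (auto simp: M_def hom(1,2))
  qed
  have FE: "field_ext K M"
    using M KM K.subfield_amb by (auto simp: field_ext_def)
  have "\<exists>p. is_min_poly K x p \<and> (\<exists>rs. set rs \<subseteq> M \<and> p = (\<Prod>r\<leftarrow>rs. [:- r, 1:]))"
    if x: "x \<in> M" for x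
  proof -
    have xN: "x \<in> N" "x \<in> L"
      using x L by (auto simp: M_def)
    obtain p where p: "is_min_poly K x p"
      using normal xN by (auto simp: normal_ext_def)
    obtain rs where rs: "set rs \<subseteq> N" "p = (\<Prod>r\<leftarrow>rs. [:- r, 1:])"
      using min_poly_splits[OF p xN(1)] .
    have "r \<in> M" if r: "r \<in> set rs" for r
    proof -
      have root: "poly p r = 0"
        using r rs prod_list_root_iff by blast
      \<comment> \<open>Every root of \<open>p\<close> in \<open>N\<close> is an image of
        \<open>x\<close> under \<open>Gal N K\<close>, hence in \<open>L\<close>. This is applied to
        \<open>r\<close> and to each \<open>\<tau> r\<close>, which is again such a root.\<close>
      have "s \<in> L" if s: "s \<in> N" "poly p s = 0" for s
      proof -
        obtain \<sigma> where "\<sigma> \<in> Gal N K" "\<sigma> x = s"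
          using conjugate_by_Gal[OF xN(1) p s] .
        with x show ?thesis by (auto simp: M_def)
      qed
      moreover have "\<tau> r \<in> N" "poly p (\<tau> r) = 0" if "\<tau> \<in> Gal N K" for \<tau>
      proof -
        interpret \<tau>: galois_automorphism K N \<tau>
          using that by (intro galois_automorphismI)
        show "\<tau> r \<in> N" "poly p (\<tau> r) = 0"
          using \<tau>.poly[of p r] root is_min_polyD(1)[OF p] r rs(1) by auto
      qed
      ultimately show ?thesis
        using root r rs(1) by (auto simp: M_def)
    qed
    with p rs(2) show ?thesis by blast
  qed
  then have "normal_ext K M"
    using FE by (auto simp: normal_ext_def)
  moreover have "separable_ext K M"
    using N FE L(3) by (auto simp: galois_ext_def separable_ext_def M_def)
  ultimately show "galois_ext K M"
    by (simp add: galois_ext_def)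
qed


section \<open>Discrete valuations\<close>

text \<open>Treats the value of 0 as infinite, which lets sums and differences be estimated without
  separating the case of cancellation to 0.\<close>

definition val_ge :: "('a::field \<Rightarrow> int) \<Rightarrow> int \<Rightarrow> 'a \<Rightarrow> bool" where
  "val_ge v k x \<longleftrightarrow> x = 0 \<or> k \<le> v x"

locale valued_field = subfld F for F :: "'a::field set" +
  fixes v :: "'a \<Rightarrow> int"
  assumes discrete_valuation: "discrete_valuation F v"
begin

lemma v_mult: "x \<in> F \<Longrightarrow> y \<in> F \<Longrightarrow> x \<noteq> 0 \<Longrightarrow> y \<noteq> 0 \<Longrightarrow> v (x * y) = v x + v y"
  using discrete_valuation by (auto simp: discrete_valuation_def)

lemma v_one [simp]: "v 1 = 0"
  using v_mult[of 1 1] by simp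

lemma v_uminus [simp]: "x \<in> F \<Longrightarrow> v (- x) = v x"
  using v_mult[of "-1" "-1"] v_mult[of "-1" x] uminus[OF one] by (cases "x = 0") auto

lemma v_inverse: "x \<in> F \<Longrightarrow> x \<noteq> 0 \<Longrightarrow> v (inverse x) = - v x"
  using v_mult[of x "inverse x"] inverse by auto

lemma v_divide: "x \<in> F \<Longrightarrow> y \<in> F \<Longrightarrow> x \<noteq> 0 \<Longrightarrow> y \<noteq> 0 \<Longrightarrow> v (x / y) = v x - v y"
  using v_mult[of x "inverse y"] v_inverse[of y] inverse[of y] by (simp add: field_simps)

lemma v_power: "x \<in> F \<Longrightarrow> x \<noteq> 0 \<Longrightarrow> v (x ^ k) = int k * v x"
  by (induction k) (auto simp: v_mult power algebra_simps)

lemma v_power_int: "x \<in> F \<Longrightarrow> x \<noteq> 0 \<Longrightarrow> v (x powi k) = k * v x"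
  by (auto simp: power_int_def v_power v_inverse inverse)

lemma surj: obtains x where "x \<in> F" "x \<noteq> 0" "v x = k"
proof -
  have "k \<in> v ` (F - {0})"
    using discrete_valuation by (auto simp: discrete_valuation_def)
  with that show ?thesis by auto
qed

lemma val_ge_0 [simp]: "val_ge v k 0"
  and val_ge_mono: "val_ge v k x \<Longrightarrow> l \<le> k \<Longrightarrow> val_ge v l x"
  by (auto simp: val_ge_def)

lemma val_ge_uminus [simp]: "x \<in> F \<Longrightarrow> val_ge v k (- x) \<longleftrightarrow> val_ge v k x"
  by (auto simp: val_ge_def)

lemma val_ge_add:
  assumes "val_ge v k x" "val_ge v k y" "x \<in> F" "y \<in> F"
  shows "val_ge v k (x + y)"
proof (cases "x = 0 \<or> y = 0 \<or> x + y = 0")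
  case False
  then have "min (v x) (v y) \<le> v (x + y)"
    using discrete_valuation assms by (auto simp: discrete_valuation_def)
  then show ?thesis
    using False assms by (auto simp: val_ge_def)
qed (use assms in \<open>auto simp: val_ge_def\<close>)

lemma val_ge_diff:
  "val_ge v k x \<Longrightarrow> val_ge v k y \<Longrightarrow> x \<in> F \<Longrightarrow> y \<in> F \<Longrightarrow> val_ge v k (x - y)"
  using val_ge_add[of k x "- y"] uminus[of y] by simp

lemma val_ge_mult:
  "val_ge v k x \<Longrightarrow> val_ge v l y \<Longrightarrow> x \<in> F \<Longrightarrow> y \<in> F \<Longrightarrow> val_ge v (k + l) (x * y)"
  by (auto simp: val_ge_def v_mult)

lemma val_ge_sum:
  "(\<And>i. i \<in> A \<Longrightarrow> f i \<in> F \<and> val_ge v k (f i)) \<Longrightarrow> val_ge v k (sum f A)"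
proof (induction A rule: infinite_finite_induct)
  case (insert a A)
  then show ?case by (simp add: val_ge_add sum)
qed auto

lemma val_ge_of_nat: "val_ge v 0 (of_nat k)"
proof (induction k)
  case (Suc k)
  then show ?case
    using val_ge_add[of 0 1 "of_nat k"] by (simp add: val_ge_def)
qed auto

lemma val_ge_infinite: "(\<And>k::nat. val_ge v (int k) x) \<Longrightarrow> x = 0"
  by (drule meta_spec[of _ "nat (v x + 1)"]) (auto simp: val_ge_def split: if_splits)

lemma dominant:
  assumes "x \<in> F" "y \<in> F" "x \<noteq> 0" "val_ge v (v x + 1) y"
  shows "x + y \<noteq> 0" "v (x + y) = v x"
proof -
  show nz: "x + y \<noteq> 0"
  proof
    assume "x + y = 0"
    then have "y = - x"
      by (simp add: eq_neg_iff_add_eq_0 add.commute)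
    then show False
      using assms by (auto simp: val_ge_def)
  qed
  have "val_ge v (v x) (x + y)"
    using assms by (intro val_ge_add val_ge_mono[OF assms(4)]) (auto simp: val_ge_def)
  moreover have "v (x + y) \<le> v x"
  proof (rule ccontr)
    assume "\<not> v (x + y) \<le> v x"
    then have "val_ge v (v x + 1) (x + y - y)"
      using assms by (intro val_ge_diff add) (auto simp: val_ge_def)
    then show False
      using assms(3) by (simp add: val_ge_def)
  qed
  ultimately show "v (x + y) = v x"
    using nz by (simp add: val_ge_def)
qed

section \<open>Principal units and their torsion\<close>

definition one_unit :: "'a \<Rightarrow> bool" where
  "one_unit x \<longleftrightarrow> x \<in> F \<and> val_ge v 1 (x - 1)"

lemma one_unitD:
  assumes "one_unit x"
  shows "x \<in> F" "val_ge v 1 (x - 1)" "x \<noteq> 0" "v x = 0" "val_ge v 0 x"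
proof -
  show x: "x \<in> F" "val_ge v 1 (x - 1)"
    using assms by (auto simp: one_unit_def)
  show "x \<noteq> 0" "v x = 0"
    using dominant[of 1 "x - 1"] x by (simp_all add: diff)
  then show "val_ge v 0 x"
    by (simp add: val_ge_def)
qed

lemma one_unit_1 [simp]: "one_unit 1"
  by (simp add: one_unit_def)

lemma one_unit_mult:
  assumes "one_unit x" "one_unit y"
  shows "one_unit (x * y)"
proof -
  note x = one_unitD[OF assms(1)] and y = one_unitD[OF assms(2)]
  have "val_ge v 1 ((x - 1) * y + (y - 1))"
    using x y val_ge_mult[of 1 "x - 1" 0 y] by (intro val_ge_add) (auto intro: diff)
  then show ?thesis
    using x y by (auto simp: one_unit_def algebra_simps)
qed

lemma one_unit_power: "one_unit x \<Longrightarrow> one_unit (x ^ k)"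
  by (induction k) (auto intro: one_unit_mult)

lemma one_unit_inverse:
  assumes "one_unit x"
  shows "one_unit (inverse x)"
proof -
  note x = one_unitD[OF assms]
  have "val_ge v (1 + 0) ((1 - x) * inverse x)"
  proof (rule val_ge_mult)
    show "val_ge v 1 (1 - x)"
      using x val_ge_uminus[of "x - 1" 1] by (simp add: diff)
    show "val_ge v 0 (inverse x)"
      using x by (simp add: val_ge_def v_inverse)
  qed (use x in \<open>auto intro: diff inverse\<close>)
  then show ?thesis
    using x by (auto simp: one_unit_def field_simps intro: inverse)
qed

text \<open>Evaluates the sums from factoring a difference of \<open>n\<close>-th powers: modulo the
  maximal ideal, every term is 1.\<close>

lemma one_unit_sum:
  assumes "\<And>i. i < k \<Longrightarrow> one_unit (f i)"
  shows "val_ge v 1 ((\<Sum>i<k. f i) - of_nat k)"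
proof -
  have "val_ge v 1 (\<Sum>i<k. f i - 1)"
    using assms by (intro val_ge_sum) (auto simp: one_unit_def intro: diff)
  then show ?thesis
    by (simp add: sum_subtractf)
qed

lemma one_unit_mod:
  assumes "val_ge v 1 (x - y)" "x \<in> F" "y \<in> F" "y \<noteq> 0" "v y = 0"
  shows "one_unit (x / y)"
proof -
  have "val_ge v (1 + 0) ((x - y) * inverse y)"
    using assms by (intro val_ge_mult) (auto simp: val_ge_def v_inverse intro: diff inverse)
  then show ?thesis
    using assms by (auto simp: one_unit_def field_simps intro: divide)
qed

lemma root_of_unity_v:
  assumes "z \<in> F" "z ^ n = 1" "n > 0"
  shows "z \<noteq> 0" "v z = 0"
proof -
  show "z \<noteq> 0"
    using assms by (auto simp: power_0_left)
  with assms show "v z = 0"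
    using v_power[of z n] by simp
qed

text \<open>A residual unit is a natural number that is prime to the residue characteristic.\<close>

definition residual_unit :: "nat \<Rightarrow> bool" where
  "residual_unit n \<longleftrightarrow> (of_nat n :: 'a) \<noteq> 0 \<and> v (of_nat n) = 0"

lemma residual_unit_pos: "residual_unit n \<Longrightarrow> n > 0"
  by (cases n) (auto simp: residual_unit_def)

text \<open>Natural numbers have nonnegative values, so a product of value 0 has factors of value
  0.\<close>

lemma residual_unit_dvd:
  assumes "residual_unit n" "m dvd n"
  shows "residual_unit m"
proof -
  obtain k where n: "n = m * k"
    using assms(2) by blast
  have "v (of_nat n) = v (of_nat m) + v (of_nat k)" "0 \<le> v (of_nat m)" "0 \<le> v (of_nat k)"
    using assms(1) n v_mult[of "of_nat m" "of_nat k"] val_ge_of_nat[of m] val_ge_of_nat[of k]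
    by (auto simp: residual_unit_def val_ge_def)
  then show ?thesis
    using assms(1) n by (auto simp: residual_unit_def)
qed

text \<open>If \<open>z \<noteq> 1\<close>, then \<open>1 + z + ... + z ^ (n - 1)\<close> vanishes,
  although it is congruent to the unit \<open>n\<close>.\<close>

lemma one_unit_torsion:
  assumes z: "one_unit z" and "z ^ n = 1" and n: "residual_unit n"
  shows "z = 1"
proof (rule ccontr)
  assume "z \<noteq> 1"
  have "(z - 1) * (\<Sum>i<n. z ^ i) = 0"
    using assms(2) by (simp add: power_diff_1_eq[symmetric])
  with \<open>z \<noteq> 1\<close> have "(\<Sum>i<n. z ^ i) = 0" by simp
  then have "val_ge v 1 (- of_nat n)"
    using one_unit_sum[of n "\<lambda>i. z ^ i"] one_unit_power[OF z] by simp
  then show False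
    using n by (simp add: val_ge_def residual_unit_def)
qed

section \<open>Completeness and roots of principal units\<close>

text \<open>Completeness with an explicit rate of convergence, the form which Newton's method
  delivers and which can be passed between \<open>K\<close> and its extensions coordinate by
  coordinate.\<close>

definition val_complete :: bool where
  "val_complete \<longleftrightarrow> (\<forall>s. (\<forall>k. s k \<in> F) \<and> (\<forall>k. val_ge v (int k) (s (Suc k) - s k)) \<longrightarrow>
     (\<exists>l\<in>F. \<forall>k. val_ge v (int k) (l - s k)))"

lemma val_ge_telescope:
  assumes s: "\<And>k. s k \<in> F" "\<And>k. val_ge v (int k) (s (Suc k) - s k)" and "j \<le> k"
  shows "val_ge v (int j) (s k - s j)"
  using \<open>j \<le> k\<close>
proof (induction k rule: dec_induct)
  case (step k)
  have "val_ge v (int j) ((s (Suc k) - s k) + (s k - s j))"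
    using step s by (intro val_ge_add val_ge_mono[OF s(2)[of k]]) (auto intro: diff)
  then show ?case by simp
qed auto

lemma mcomplete_imp_val_complete:
  assumes "Metric_space.mcomplete F (val_dist F v)"
  shows val_complete
  unfolding val_complete_def
proof (intro allI impI)
  fix s :: "nat \<Rightarrow> 'a"
  assume "(\<forall>k. s k \<in> F) \<and> (\<forall>k. val_ge v (int k) (s (Suc k) - s k))"
  then have s: "\<And>k. s k \<in> F" "\<And>k. val_ge v (int k) (s (Suc k) - s k)" by auto
  interpret M: Metric_space F "val_dist F v"
    by (rule Metric_space_val_dist[OF subfield_amb discrete_valuation])
  have dist: "val_dist F v (s j) (s k) \<le> 2 powi (- int N)" if "j \<ge> N" "k \<ge> N" for j k N
  proof (cases "s j = s k")
    case False
    have "val_ge v (int N) ((s j - s N) - (s k - s N))"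
      by (rule val_ge_diff) (use val_ge_telescope[of s, OF s] that s(1) in \<open>auto intro: diff\<close>)
    then have "int N \<le> v (s j - s k)"
      using False by (simp add: val_ge_def)
    then show ?thesis
      using False s(1) by (auto simp: val_dist_def intro!: power_int_increasing)
  qed (auto simp: val_dist_def)
  have "M.MCauchy s"
    unfolding M.MCauchy_def
  proof (intro conjI allI impI)
    fix \<epsilon> :: real assume "\<epsilon> > 0"
    then obtain N where "(1 / 2) ^ N < \<epsilon>"
      using real_arch_pow_inv[of \<epsilon> "1 / 2"] by auto
    then have N: "2 powi (- int N) < \<epsilon>"
      by (simp add: power_int_minus power_int_of_nat field_simps power_divide)
    show "\<exists>N. \<forall>j k. N \<le> j \<longrightarrow> N \<le> k \<longrightarrow> val_dist F v (s j) (s k) < \<epsilon>"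
      using dist N by (meson le_less_trans)
  qed (use s in auto)
  then obtain l where "limitin M.mtopology s l sequentially"
    using assms M.mcomplete_def by blast
  then have l: "l \<in> F" "\<And>\<epsilon>. \<epsilon> > 0 \<Longrightarrow> \<exists>N. \<forall>n\<ge>N. val_dist F v (s n) l < \<epsilon>"
    unfolding M.limitin_metric eventually_sequentially by blast+
  have "val_ge v (int k) (l - s k)" for k
  proof -
    obtain N where N: "\<forall>n\<ge>N. val_dist F v (s n) l < 2 powi (- int k)"
      using l(2)[of "2 powi (- int k)"] by auto
    \<comment> \<open>Far enough for \<open>s j\<close> to be close to \<open>l\<close>, and at
      least \<open>k\<close> so that the telescoping bound compares \<open>s j\<close> with
      \<open>s k\<close>.\<close>
    define j where "j = max N k"
    have "val_dist F v (s j) l < 2 powi (- int k)"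
      using N by (auto simp: j_def)
    then have "val_ge v (int k) (s j - l)"
      using l(1) s(1) power_int_increasing[of "- int k" "- v (s j - l)" "2::real"]
      by (force simp: val_dist_def val_ge_def split: if_splits)
    then have "val_ge v (int k) ((s j - s k) - (s j - l))"
      using val_ge_telescope[of s, OF s, of k j] s(1) l(1)
      by (intro val_ge_diff[of _ "s j - s k" "s j - l"]) (auto simp: j_def intro: diff)
    then show ?thesis by simp
  qed
  with l(1) show "\<exists>l\<in>F. \<forall>k. val_ge v (int k) (l - s k)" by blast
qed

text \<open>Newton's method for \<open>y ^ n = u\<close>, with the derivative frozen at its residue \<open>n\<close>.\<close>

lemma one_unit_root_exists:
  assumes complete: val_complete and n: "residual_unit n" and u: "one_unit u"
  obtains y where "one_unit y" "y ^ n = u"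
proof -
  define \<phi> where "\<phi> y = y - (y ^ n - u) / of_nat n" for y
  define s where "s k = (\<phi> ^^ k) 1" for k
  have s0: "s 0 = 1" and sS: "s (Suc k) = \<phi> (s k)" for k
    by (auto simp: s_def)
  have nF: "of_nat n \<in> F" "(of_nat n :: 'a) \<noteq> 0" "v (of_nat n) = 0"
    using n by (auto simp: residual_unit_def)
  note U = one_unitD[OF u]
  have div: "val_ge v k (x / of_nat n)" if "val_ge v k x" "x \<in> F" for k x
    using that nF by (auto simp: val_ge_def v_divide)
  have step: "one_unit (\<phi> y) \<and> val_ge v (k + 1) (\<phi> y ^ n - u) \<and> val_ge v k (\<phi> y - y)"
    if y: "one_unit y" "val_ge v k (y ^ n - u)" "k \<ge> 1" for y k
  proof -
    define a where "a = (y ^ n - u) / of_nat n"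
    note Y = one_unitD[OF y(1)]
    have aF: "a \<in> F"
      unfolding a_def using Y U nF by (auto intro!: divide diff power)
    have a: "val_ge v k a"
      unfolding a_def using div[OF y(2)] Y U by (auto intro!: diff power)
    have \<phi>: "\<phi> y = y - a"
      by (simp add: \<phi>_def a_def)
    have "val_ge v 1 ((y - 1) - a)"
      using Y a aF y(3) by (intro val_ge_diff[of _ "y - 1"]) (auto intro: diff val_ge_mono)
    then have one: "one_unit (\<phi> y)"
      using Y aF by (auto simp: \<phi> one_unit_def algebra_simps intro: diff)
    define \<Sigma> where "\<Sigma> = (\<Sum>i<n. y ^ (n - Suc i) * \<phi> y ^ i)"
    have \<Sigma>: "val_ge v 1 (\<Sigma> - of_nat n)" "\<Sigma> \<in> F"
      unfolding \<Sigma>_def using one y(1) one_unitD(1)[OF one] Y(1)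
      by (auto intro!: one_unit_sum one_unit_mult one_unit_power sum mult power)
    have "\<phi> y ^ n - u = (\<phi> y ^ n - y ^ n) + (y ^ n - u)" by simp
    also have "\<phi> y ^ n - y ^ n = - a * \<Sigma>"
      unfolding \<Sigma>_def power_diff_sumr2 by (simp add: \<phi>)
    also have "y ^ n - u = a * of_nat n"
      using nF by (simp add: a_def)
    \<comment> \<open>The old error \<open>a * n\<close> cancels against the main part of the
      correction \<open>- a * \<Sigma>\<close>. As \<open>\<Sigma>\<close> is congruent to
      \<open>n\<close>, the new error gains one in value.\<close>
    finally have "\<phi> y ^ n - u = - (a * (\<Sigma> - of_nat n))"
      by (simp add: algebra_simps)
    moreover have "val_ge v (k + 1) (a * (\<Sigma> - of_nat n))"
      using a aF \<Sigma> nF by (intro val_ge_mult) (auto intro: diff)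
    ultimately have "val_ge v (k + 1) (\<phi> y ^ n - u)"
      using aF \<Sigma> nF by (auto simp: mult diff)
    moreover have "val_ge v k (\<phi> y - y)"
      using a aF by (simp add: \<phi>)
    ultimately show ?thesis
      using one by blast
  qed
  \<comment> \<open>The shift by one is already available at the start: \<open>s 0 = 1\<close> has
    error \<open>1 - u\<close>, and \<open>u\<close> is a principal unit.\<close>
  have s: "one_unit (s k) \<and> val_ge v (int k + 1) (s k ^ n - u)" for k
  proof (induction k)
    case 0
    then show ?case
      using U val_ge_uminus[of "u - 1" 1] by (simp add: s0 diff)
  next
    case (Suc k)
    then show ?case
      using step[of "s k" "int k + 1"] by (simp add: sS add.commute)
  qed
  have sF: "s k \<in> F" for k
    using s one_unitD by blast
  have "val_ge v (int k) (s (Suc k) - s k)" for k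
    using step[of "s k" "int k + 1"] s[of k] val_ge_mono[of "int k + 1" _ "int k"] by (auto simp: sS)
  then obtain l where l: "l \<in> F" "\<And>k. val_ge v (int k) (l - s k)"
    using complete sF unfolding val_complete_def by blast
  have "val_ge v 1 ((l - s 1) + (s 1 - 1))"
    using l(1) l(2)[of 1] s[of 1] sF by (intro val_ge_add) (auto simp: one_unit_def intro: diff)
  then have one: "one_unit l"
    using l by (simp add: one_unit_def)
  have "val_ge v (int k) (l ^ n - u)" for k
  proof -
    have "val_ge v (int k + 0) ((l - s k) * (\<Sum>i<n. s k ^ (n - Suc i) * l ^ i))"
    proof (rule val_ge_mult)
      show "val_ge v 0 (\<Sum>i<n. s k ^ (n - Suc i) * l ^ i)"
        using s[of k] one by (intro val_ge_sum conjI one_unitD one_unit_mult one_unit_power) auto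
    qed (use l s sF in \<open>auto intro!: diff sum mult power\<close>)
    then have "val_ge v (int k) ((l ^ n - s k ^ n) + (s k ^ n - u))"
      using l sF U s[of k] unfolding power_diff_sumr2
      by (intro val_ge_add) (auto intro!: diff sum mult power intro: val_ge_mono)
    then show ?thesis by simp
  qed
  then have "l ^ n = u"
    using val_ge_infinite[of "l ^ n - u"] by simp
  with one that show ?thesis by blast
qed

end


section \<open>Finite sums and the library notion of dimension\<close>

lemma amb_simps [simp]:
  "carrier amb = UNIV" "\<zero>\<^bsub>amb\<^esub> = 0" "\<one>\<^bsub>amb\<^esub> = 1"
  "x \<oplus>\<^bsub>amb\<^esub> y = x + y" "x \<otimes>\<^bsub>amb\<^esub> y = x * y"
  by (auto simp: ring_of_type_algebra_def)

lemma combine_amb: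
  "ring.combine amb (map c [0..<k]) (map b [0..<k]) = (\<Sum>i<k. c i * b i :: 'a::field)"
proof -
  interpret A: Ring.field "amb :: 'a ring"
    by (rule field_from_type_algebra)
  have *: "A.combine Ks Us = (\<Sum>(x, y)\<leftarrow>zip Ks Us. x * y)" for Ks Us
    by (induction Ks Us rule: A.combine.induct) auto
  show ?thesis
    unfolding * by (simp add: zip_map_map zip_same_conv_map o_def
        interv_sum_list_conv_sum_set_nat atLeast0LessThan)
qed

context subfld
begin

lemma independent_ambI:
  assumes "\<And>c. (\<And>i. i < k \<Longrightarrow> c i \<in> F) \<Longrightarrow> (\<Sum>i<k. c i * b i) = 0 \<Longrightarrow> \<forall>i<k. c i = 0"
  shows "ring.independent amb F (map b [0..<k])"
proof -
  interpret A: Ring.field "amb :: 'a ring"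
    by (rule field_from_type_algebra)
  show ?thesis
  proof (rule A.trivial_combine_imp_independent[OF subfield_amb])
    fix Ks
    assume Ks: "set Ks \<subseteq> F" "A.combine Ks (map b [0..<k]) = \<zero>\<^bsub>amb\<^esub>"
    \<comment> \<open>Coefficient lists may have any length here, so \<open>Ks\<close> is first
      truncated or padded with zeros to length \<open>k\<close>.\<close>
    then obtain Ks' where Ks': "set (take k Ks) \<subseteq> set Ks'" "set Ks' \<subseteq> set (take k Ks) \<union> {0}"
        "length Ks' = k" "A.combine Ks' (map b [0..<k]) = 0"
      using A.combine_normalize[of Ks "map b [0..<k]" 0] by auto
    have "Ks' = map (\<lambda>i. Ks' ! i) [0..<k]"
      using Ks'(3) map_nth[of Ks'] by simp
    then have "(\<Sum>i<k. Ks' ! i * b i) = 0"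
      using Ks'(4) combine_amb[of "\<lambda>i. Ks' ! i" k b] by simp
    moreover have "Ks' ! i \<in> F" if "i < k" for i
    proof -
      have "set Ks' \<subseteq> F"
        using Ks'(2) Ks(1) set_take_subset[of k Ks] by auto
      then show ?thesis
        using that Ks'(3) nth_mem[of i Ks'] by auto
    qed
    ultimately have "\<forall>i<k. Ks' ! i = 0"
      using assms[of "\<lambda>i. Ks' ! i"] by blast
    then show "set (take (length (map b [0..<k])) Ks) \<subseteq> {\<zero>\<^bsub>amb\<^esub>}"
      using Ks'(1,3) by (auto simp: in_set_conv_nth subset_iff)
  qed auto
qed

lemma Span_amb:
  "ring.Span amb F (map b [0..<k]) = {\<Sum>i<k. c i * b i |c. \<forall>i. c i \<in> F}"
proof -
  interpret A: Ring.field "amb :: 'a ring"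
    by (rule field_from_type_algebra)
  have "A.Span F (map b [0..<k]) = {A.combine Ks (map b [0..<k]) |Ks. length Ks = k \<and> set Ks \<subseteq> F}"
    using A.Span_eq_combine_set_length_version[OF subfield_amb, of "map b [0..<k]"] by simp
  also have "\<dots> = {\<Sum>i<k. c i * b i |c. \<forall>i. c i \<in> F}"
  proof (intro equalityI subsetI)
    fix x assume "x \<in> {A.combine Ks (map b [0..<k]) |Ks. length Ks = k \<and> set Ks \<subseteq> F}"
    then obtain Ks where Ks: "x = A.combine Ks (map b [0..<k])" "length Ks = k" "set Ks \<subseteq> F"
      by auto
    define c where "c i = (if i < k then Ks ! i else 0)" for i
    have "Ks = map c [0..<k]"
      using Ks(2) by (auto simp: list_eq_iff_nth_eq c_def)
    then have "x = (\<Sum>i<k. c i * b i)"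
      using Ks(1) combine_amb[of c k b] by simp
    moreover have "c i \<in> F" for i
      using Ks(2,3) nth_mem[of i Ks] by (auto simp: c_def)
    ultimately show "x \<in> {\<Sum>i<k. c i * b i |c. \<forall>i. c i \<in> F}" by blast
  next
    fix x assume "x \<in> {\<Sum>i<k. c i * b i |c. \<forall>i. c i \<in> F}"
    then obtain c where c: "x = (\<Sum>i<k. c i * b i)" "\<forall>i. c i \<in> F" by auto
    then show "x \<in> {A.combine Ks (map b [0..<k]) |Ks. length Ks = k \<and> set Ks \<subseteq> F}"
      using combine_amb[of c k b] by (intro CollectI exI[of _ "map c [0..<k]"]) auto
  qed
  finally show ?thesis .
qed

text \<open>In dimension \<open>k\<close>, independence of \<open>k\<close> elements already forces
  them to span; thus a comparison of values is enough to produce a basis.\<close>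

lemma independent_spans:
  assumes "ring.dimension amb k F E" "\<And>i. i < k \<Longrightarrow> b i \<in> E"
    and "\<And>c. (\<And>i. i < k \<Longrightarrow> c i \<in> F) \<Longrightarrow> (\<Sum>i<k. c i * b i) = 0 \<Longrightarrow> \<forall>i<k. c i = 0"
    and x: "x \<in> E"
  obtains c where "\<And>i. c i \<in> F" "x = (\<Sum>i<k. c i * b i)"
proof -
  interpret A: Ring.field "amb :: 'a ring"
    by (rule field_from_type_algebra)
  have "set (map b [0..<k]) \<subseteq> E"
    using assms(2) by auto
  then have "A.Span F (map b [0..<k]) = E"
    using A.independent_length_eq_dimension[OF subfield_amb assms(1) independent_ambI[OF assms(3)]]
    by simp
  with x that show ?thesis
    unfolding Span_amb by blast
qed

lemma dimension_ambI:
  assumes "\<And>c. (\<And>i. i < k \<Longrightarrow> c i \<in> F) \<Longrightarrow> (\<Sum>i<k. c i * b i) = 0 \<Longrightarrow> \<forall>i<k. c i = 0"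
    and "\<And>c. (\<And>i. c i \<in> F) \<Longrightarrow> (\<Sum>i<k. c i * b i) \<in> E"
    and "\<And>x. x \<in> E \<Longrightarrow> \<exists>c. (\<forall>i. c i \<in> F) \<and> x = (\<Sum>i<k. c i * b i)"
  shows "ring.dimension amb k F E"
proof -
  interpret A: Ring.field "amb :: 'a ring"
    by (rule field_from_type_algebra)
  have "A.Span F (map b [0..<k]) = E"
    using assms(2,3) unfolding Span_amb by blast
  then show ?thesis
    using A.dimensionI[OF subfield_amb independent_ambI[OF assms(1)]] by simp
qed

end


section \<open>Totally ramified extensions\<close>

text \<open>The one parameter \<open>m\<close> is both ramification index and dimension. This
  coincidence turns any elements of values \<open>0\<close>, ..., \<open>m - 1\<close> into a
  basis.\<close>

locale totally_ramified_ext = K: valued_field K v + T: valued_field T w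
  for K :: "'a::field set" and v and T :: "'a set" and w +
  fixes m :: nat
  assumes K_sub_T: "K \<subseteq> T" and m_pos: "m > 0"
    and w_K: "\<And>x. x \<in> K \<Longrightarrow> x \<noteq> 0 \<Longrightarrow> w x = int m * v x"
    and dimension: "ring.dimension amb m K T"
begin

lemma K_in_T [intro]: "x \<in> K \<Longrightarrow> x \<in> T"
  using K_sub_T by auto

lemma val_ge_K_iff: "x \<in> K \<Longrightarrow> val_ge w 1 x \<longleftrightarrow> val_ge v 1 x"
  by (cases "x = 0") (use m_pos zero_less_mult_iff[of "int m" "v x"] w_K[of x] in
      \<open>auto simp: val_ge_def int_one_le_iff_zero_less\<close>)

lemma one_unit_K_iff: "x \<in> K \<Longrightarrow> T.one_unit x \<longleftrightarrow> K.one_unit x"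
  by (auto simp: T.one_unit_def K.one_unit_def val_ge_K_iff K.diff)

lemma residual_unit_iff: "T.residual_unit k \<longleftrightarrow> K.residual_unit k"
  using m_pos w_K[of "of_nat k"] by (auto simp: T.residual_unit_def K.residual_unit_def)

text \<open>
  The values of the terms of \<open>\<Sum>i<k. c i * b i\<close> are pairwise incongruent modulo \<open>m\<close>, so exactly
  one term has minimal value.
\<close>

lemma dominant_term:
  assumes b: "\<And>i. i < k \<Longrightarrow> b i \<in> T \<and> b i \<noteq> 0 \<and> w (b i) = int i" and k: "k \<le> m"
    and c: "\<And>i. i < k \<Longrightarrow> c i \<in> K" and nz: "\<exists>i<k. c i \<noteq> 0"
  shows "(\<Sum>i<k. c i * b i) \<noteq> 0"
    and "\<exists>j<k. c j \<noteq> 0 \<and> w (\<Sum>i<k. c i * b i) = int m * v (c j) + int j"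
    and "\<forall>i<k. c i \<noteq> 0 \<longrightarrow> w (\<Sum>i<k. c i * b i) \<le> int m * v (c i) + int i"
proof -
  have wt: "c i * b i \<in> T" "c i \<noteq> 0 \<Longrightarrow> w (c i * b i) = int m * v (c i) + int i"
    if "i < k" for i
    using b[OF that] c[OF that] by (auto simp: T.v_mult K_in_T w_K)
  define A where "A = {i. i < k \<and> c i \<noteq> 0}"
  have A: "finite A" "A \<noteq> {}"
    using nz by (auto simp: A_def)
  define j where "j = arg_min_on (\<lambda>i. w (c i * b i)) A"
  have j: "j \<in> A"
    unfolding j_def using arg_min_if_finite(1)[OF A] .
  have min: "w (c j * b j) \<le> w (c i * b i)" if "i \<in> A" for i
    unfolding j_def using arg_min_least[OF A that] .
  have strict: "w (c j * b j) + 1 \<le> w (c i * b i)" if "i \<in> A" "i \<noteq> j" for i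
  proof (rule ccontr)
    assume "\<not> ?thesis"
    then have "w (c j * b j) = w (c i * b i)"
      using min[OF that(1)] by simp
    then have "int m * v (c j) + int j = int m * v (c i) + int i"
      using wt(2)[of i] wt(2)[of j] j that(1) by (simp add: A_def)
    then have "(int m * v (c j) + int j) mod int m = (int m * v (c i) + int i) mod int m"
      by simp
    then have "int j mod int m = int i mod int m"
      by simp
    then show False
      using that j k by (simp add: A_def)
  qed
  have jk: "j < k" "c j \<noteq> 0"
    using j by (auto simp: A_def)
  have split: "(\<Sum>i<k. c i * b i) = c j * b j + (\<Sum>i\<in>{..<k} - {j}. c i * b i)"
    using jk by (simp add: sum.remove)
  have rest: "val_ge w (w (c j * b j) + 1) (\<Sum>i\<in>{..<k} - {j}. c i * b i)"
  proof (rule T.val_ge_sum)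
    fix i assume i: "i \<in> {..<k} - {j}"
    then show "c i * b i \<in> T \<and> val_ge w (w (c j * b j) + 1) (c i * b i)"
      using wt(1)[of i] strict[of i] by (cases "c i = 0") (auto simp: val_ge_def A_def)
  qed
  have restT: "(\<Sum>i\<in>{..<k} - {j}. c i * b i) \<in> T"
    using wt(1) by (intro T.sum) auto
  have "c j * b j \<noteq> 0"
    using jk b by auto
  note dom = T.dominant[OF wt(1)[OF jk(1)] restT this rest]
  show "(\<Sum>i<k. c i * b i) \<noteq> 0"
    using dom(1) split by simp
  have w: "w (\<Sum>i<k. c i * b i) = w (c j * b j)"
    using dom(2) split by simp
  show "\<exists>j<k. c j \<noteq> 0 \<and> w (\<Sum>i<k. c i * b i) = int m * v (c j) + int j"
    using w wt(2)[OF jk] jk by auto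
  show "\<forall>i<k. c i \<noteq> 0 \<longrightarrow> w (\<Sum>i<k. c i * b i) \<le> int m * v (c i) + int i"
    using w wt(2) min by (metis (mono_tags, lifting) A_def mem_Collect_eq)
qed

lemma combination_zero:
  assumes "\<And>i. i < k \<Longrightarrow> b i \<in> T \<and> b i \<noteq> 0 \<and> w (b i) = int i" "k \<le> m"
    and "\<And>i. i < k \<Longrightarrow> c i \<in> K" "(\<Sum>i<k. c i * b i) = 0"
  shows "\<forall>i<k. c i = 0"
  using dominant_term(1)[of k b c] assms by blast

lemma basis:
  assumes "\<And>i. i < m \<Longrightarrow> b i \<in> T \<and> b i \<noteq> 0 \<and> w (b i) = int i" and "x \<in> T"
  obtains c where "\<And>i. c i \<in> K" "x = (\<Sum>i<m. c i * b i)"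
proof (rule K.independent_spans[OF dimension, of b x])
  show "b i \<in> T" if "i < m" for i
    using assms(1)[OF that] by blast
  show "\<forall>i<m. c i = 0" if "\<And>i. i < m \<Longrightarrow> c i \<in> K" "(\<Sum>i<m. c i * b i) = 0" for c
    using combination_zero[of m b c] assms(1) that by blast
qed (use assms that in auto)

text \<open>Since the terms cannot cancel, a lower bound for the value of the sum holds for every
  term. In particular, taking coordinates is continuous.\<close>

lemma coefficient_bound:
  assumes b: "\<And>i. i < m \<Longrightarrow> b i \<in> T \<and> b i \<noteq> 0 \<and> w (b i) = int i"
    and c: "\<And>i. i < m \<Longrightarrow> c i \<in> K"
    and x: "val_ge w k (\<Sum>i<m. c i * b i)" and i: "i < m"
  shows "c i = 0 \<or> k \<le> int m * v (c i) + int i"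
proof (cases "c i = 0")
  case False
  then have "\<exists>i<m. c i \<noteq> 0"
    using i by blast
  note dom = dominant_term[OF b order_refl c this]
  show ?thesis
    using dom(1,3) x i False by (auto simp: val_ge_def)
qed auto

lemma uniformizer_basis:
  assumes "\<theta> \<in> T" "\<theta> \<noteq> 0" "w \<theta> = 1"
  shows "\<theta> ^ i \<in> T \<and> \<theta> ^ i \<noteq> 0 \<and> w (\<theta> ^ i) = int i"
  using assms by (auto simp: T.v_power)

text \<open>The residue field does not grow: for \<open>0 < i < m\<close> the value of
  \<open>c i * \<theta> ^ i\<close> is prevented by its class modulo \<open>m\<close> from being 0,
  so a nonnegative one is positive, and only the coefficient \<open>c 0\<close> is left modulo the
  maximal ideal.\<close>

lemma residue_representative:
  assumes x: "x \<in> T" "val_ge w 0 x"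
  obtains a where "a \<in> K" "val_ge w 1 (x - a)"
proof -
  obtain \<theta> where \<theta>: "\<theta> \<in> T" "\<theta> \<noteq> 0" "w \<theta> = 1"
    using T.surj[of 1] by blast
  note b = uniformizer_basis[OF \<theta>]
  obtain c where c: "\<And>i. c i \<in> K" "x = (\<Sum>i<m. c i * \<theta> ^ i)"
    using basis[of "\<lambda>i. \<theta> ^ i", OF b x(1)] by blast
  have "{..<m} = insert 0 {1..<m}"
    using m_pos by auto
  then have "x - c 0 = (\<Sum>i\<in>{1..<m}. c i * \<theta> ^ i)"
    using c(2) by simp
  moreover have "val_ge w 1 (\<Sum>i\<in>{1..<m}. c i * \<theta> ^ i)"
  proof (rule T.val_ge_sum)
    fix i assume i: "i \<in> {1..<m}"
    have "c i = 0 \<or> 0 \<le> int m * v (c i) + int i"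
      using coefficient_bound[of "\<lambda>i. \<theta> ^ i" c 0 i, OF b] c x(2) i by auto
    moreover have "int m * v (c i) + int i \<noteq> 0"
    proof
      assume "int m * v (c i) + int i = 0"
      then have "(int m * v (c i) + int i) mod int m = 0" by simp
      then show False
        using i by simp
    qed
    ultimately have "c i = 0 \<or> 1 \<le> int m * v (c i) + int i" by auto
    then show "c i * \<theta> ^ i \<in> T \<and> val_ge w 1 (c i * \<theta> ^ i)"
      using b[of i] c(1)[of i] by (auto simp: val_ge_def T.v_mult K_in_T w_K)
  qed
  ultimately show ?thesis
    using that c(1) by metis
qed

lemma unit_residue_representative:
  assumes x: "x \<in> T" "x \<noteq> 0" "w x = 0"
  obtains a where "a \<in> K" "a \<noteq> 0" "T.one_unit (x / a)"
proof -
  obtain a where a: "a \<in> K" "val_ge w 1 (x - a)"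
    using residue_representative[of x] x by (auto simp: val_ge_def)
  have "val_ge w (w x + 1) (a - x)"
    using a x T.val_ge_uminus[of "x - a" 1] by (auto intro: T.diff)
  then have "a \<noteq> 0" "w a = 0"
    using T.dominant[of x "a - x"] a x by (auto intro: T.diff)
  then show ?thesis
    using that a x T.one_unit_mod[of x a] by auto
qed

text \<open>The coordinates with respect to the powers of a uniformizer form Cauchy sequences in
  \<open>K\<close>, and the limit is assembled from theirs.\<close>

lemma val_complete:
  assumes "K.val_complete"
  shows "T.val_complete"
  unfolding T.val_complete_def
proof (intro allI impI)
  fix s :: "nat \<Rightarrow> 'a"
  assume "(\<forall>k. s k \<in> T) \<and> (\<forall>k. val_ge w (int k) (s (Suc k) - s k))"
  then have s: "\<And>k. s k \<in> T" "\<And>k. val_ge w (int k) (s (Suc k) - s k)" by auto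
  note tele = T.val_ge_telescope[of s, OF s]
  obtain \<theta> where \<theta>: "\<theta> \<in> T" "\<theta> \<noteq> 0" "w \<theta> = 1"
    using T.surj[of 1] by blast
  note b = uniformizer_basis[OF \<theta>]
  \<comment> \<open>Values in \<open>T\<close> are scaled by \<open>m\<close>: along this
    subsequence, differences of value \<open>m * Suc k\<close> in \<open>T\<close> have coordinates
    of value at least \<open>k\<close> in \<open>K\<close>.\<close>
  define t where "t k = s (m * Suc k)" for k
  have "\<exists>c. (\<forall>i. c i \<in> K) \<and> t k = (\<Sum>i<m. c i * \<theta> ^ i)" for k
    using basis[of "\<lambda>i. \<theta> ^ i" "t k", OF b] s(1) unfolding t_def by metis
  then obtain c where c: "\<And>k i. c k i \<in> K" "\<And>k. t k = (\<Sum>i<m. c k i * \<theta> ^ i)"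
    by metis
  have cauchy: "val_ge v (int k) (c (Suc k) i - c k i)" if i: "i < m" for i k
  proof -
    have "val_ge w (int (m * Suc k)) (\<Sum>i<m. (c (Suc k) i - c k i) * \<theta> ^ i)"
      using tele[of "m * Suc k" "m * Suc (Suc k)"] c(2)[of k] c(2)[of "Suc k"]
      by (simp add: t_def sum_subtractf algebra_simps)
    from coefficient_bound[of "\<lambda>i. \<theta> ^ i", OF b _ this i]
    have "c (Suc k) i - c k i = 0 \<or> int (m * Suc k) \<le> int m * v (c (Suc k) i - c k i) + int i"
      using c(1) by (auto intro: K.diff)
    moreover have "int k \<le> d" if "int (m * Suc k) \<le> int m * d + int i" for d
    proof -
      have "int m * (int k + 1) < int m * (d + 1)"
        using that i by (simp only: of_nat_mult of_nat_Suc distrib_left mult_1_right)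
      then have "int k + 1 < d + 1"
        using m_pos by (simp add: mult_less_cancel_left)
      then show ?thesis by simp
    qed
    ultimately show ?thesis
      by (auto simp: val_ge_def)
  qed
  have "\<exists>l\<in>K. \<forall>k. val_ge v (int k) (l - c k i)" if "i < m" for i
    using assms[unfolded K.val_complete_def, THEN spec, of "\<lambda>k. c k i"] cauchy[OF that] c(1)
    by simp
  then obtain l where l: "\<And>i. i < m \<Longrightarrow> l i \<in> K" "\<And>i k. i < m \<Longrightarrow> val_ge v (int k) (l i - c k i)"
    by metis
  define L where "L = (\<Sum>i<m. l i * \<theta> ^ i)"
  have LT: "L \<in> T"
    unfolding L_def using l(1) b by (intro T.sum T.mult) auto
  have Lt: "val_ge w (int (m * k)) (L - t k)" for k
  proof -
    have "val_ge w (int (m * k)) (\<Sum>i<m. (l i - c k i) * \<theta> ^ i)"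
    proof (rule T.val_ge_sum)
      fix i assume "i \<in> {..<m}"
      then have i: "i < m" by simp
      have "l i - c k i \<in> K" "val_ge v (int k) (l i - c k i)"
        using l i c(1) by (auto intro: K.diff)
      then have "l i - c k i \<in> T \<and> val_ge w (int (m * k)) (l i - c k i)"
        using m_pos by (auto simp: val_ge_def w_K)
      then show "(l i - c k i) * \<theta> ^ i \<in> T \<and> val_ge w (int (m * k)) ((l i - c k i) * \<theta> ^ i)"
        using b[of i] T.val_ge_mult[of "int (m * k)" "l i - c k i" 0 "\<theta> ^ i"]
        by (auto simp: val_ge_def intro: T.mult)
    qed
    then show ?thesis
      by (simp add: L_def c(2) sum_subtractf algebra_simps)
  qed
  have "val_ge w (int k) (L - s k)" for k
  proof -
    have "k \<le> m * k"
      using m_pos by simp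
    then have "val_ge w (int k) (L - t k)"
      using T.val_ge_mono[OF Lt[of k], of "int k"] by (simp only: of_nat_le_iff)
    moreover have "k \<le> m * Suc k"
      by (rule le_trans[OF \<open>k \<le> m * k\<close>]) simp
    then have "val_ge w (int k) (t k - s k)"
      unfolding t_def by (rule tele)
    ultimately have "val_ge w (int k) ((L - t k) + (t k - s k))"
      using LT s(1) by (intro T.val_ge_add) (auto simp: t_def intro: T.diff)
    then show ?thesis by simp
  qed
  with LT show "\<exists>l\<in>T. \<forall>k. val_ge w (int k) (l - s k)" by blast
qed

section \<open>Radical generators and roots of unity in tame totally ramified extensions\<close>

text \<open>Since the residue field does not grow, the unit
  \<open>\<theta>\<^sub>0 ^ m / \<pi>\<close> is an element \<open>a\<close> of \<open>K\<close>
  times a principal unit \<open>y ^ m\<close>. Dividing \<open>\<theta>\<^sub>0\<close> by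
  \<open>y\<close> leaves the \<open>m\<close>-th power \<open>a * \<pi>\<close>.\<close>

theorem tame_radical_uniformizer:
  assumes "K.val_complete" "K.residual_unit m"
  obtains \<theta> where "\<theta> \<in> T" "\<theta> \<noteq> 0" "w \<theta> = 1" "\<theta> ^ m \<in> K"
proof -
  obtain \<theta>\<^sub>0 where \<theta>\<^sub>0: "\<theta>\<^sub>0 \<in> T" "\<theta>\<^sub>0 \<noteq> 0" "w \<theta>\<^sub>0 = 1"
    using T.surj[of 1] by blast
  obtain \<pi> where \<pi>: "\<pi> \<in> K" "\<pi> \<noteq> 0" "v \<pi> = 1"
    using K.surj[of 1] by blast
  have "\<theta>\<^sub>0 ^ m / \<pi> \<in> T" "\<theta>\<^sub>0 ^ m / \<pi> \<noteq> 0" "w (\<theta>\<^sub>0 ^ m / \<pi>) = 0"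
    using \<theta>\<^sub>0 \<pi> by (auto simp: T.v_divide T.v_power T.power K_in_T w_K)
  then obtain a where a: "a \<in> K" "a \<noteq> 0" "T.one_unit (\<theta>\<^sub>0 ^ m / \<pi> / a)"
    using unit_residue_representative by blast
  obtain y where y: "T.one_unit y" "y ^ m = \<theta>\<^sub>0 ^ m / \<pi> / a"
    using T.one_unit_root_exists[OF val_complete[OF assms(1)] _ a(3)] assms(2) residual_unit_iff
    by blast
  note Y = T.one_unitD[OF y(1)]
  have "(\<theta>\<^sub>0 / y) ^ m = a * \<pi>"
    using y(2) a(2) \<pi>(2) \<theta>\<^sub>0(2) by (simp add: power_divide)
  then have "(\<theta>\<^sub>0 / y) ^ m \<in> K"
    using a \<pi> by auto
  moreover have "\<theta>\<^sub>0 / y \<in> T" "\<theta>\<^sub>0 / y \<noteq> 0" "w (\<theta>\<^sub>0 / y) = 1"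
    using Y \<theta>\<^sub>0 by (auto simp: T.v_divide)
  ultimately show ?thesis
    using that by blast
qed

text \<open>Approximate \<open>z\<close> by \<open>a\<close> in \<open>K\<close> up to a principal
  unit. Then \<open>(z / a) ^ n = 1 / a ^ n\<close> is a principal unit of \<open>K\<close>, so it
  has an \<open>n\<close>-th root \<open>y\<close> there, and \<open>z / (a * y)\<close> is a
  principal unit that is \<open>n\<close>-torsion, hence 1.\<close>

theorem root_of_unity_in_base:
  assumes complete: "K.val_complete" and n: "K.residual_unit n" and z: "z \<in> T" "z ^ n = 1"
  shows "z \<in> K"
proof -
  note z' = T.root_of_unity_v[OF z K.residual_unit_pos[OF n]]
  obtain a where a: "a \<in> K" "a \<noteq> 0" "T.one_unit (z / a)"
    using unit_residue_representative[OF z(1) z'] by blast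
  have "T.one_unit ((z / a) ^ n)"
    using a(3) by (rule T.one_unit_power)
  then have "K.one_unit (1 / a ^ n)"
    using a z(2) by (subst one_unit_K_iff[symmetric]) (auto simp: power_divide)
  then obtain y where y: "K.one_unit y" "y ^ n = 1 / a ^ n"
    using K.one_unit_root_exists[OF complete n] by blast
  have yT: "T.one_unit y" "y \<in> K" "y \<noteq> 0"
    using y(1) K.one_unitD one_unit_K_iff by auto
  have "T.one_unit (z / a * inverse y)"
    using a(3) yT(1) by (intro T.one_unit_mult T.one_unit_inverse)
  moreover have "(z / a * inverse y) ^ n = 1"
    using a y(2) z(2) by (simp add: power_mult_distrib power_divide power_inverse)
  ultimately have "z / a * inverse y = 1"
    using n residual_unit_iff T.one_unit_torsion by blast
  then have "z = a * y"
    using a(2) yT(3) by (simp add: field_simps)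
  then show ?thesis
    using a(1) yT(2) by auto
qed

text \<open>A nonzero polynomial over \<open>K\<close> of degree below \<open>m\<close> takes a
  nonzero value at \<open>\<theta>\<close>, because its terms cannot cancel.\<close>

lemma is_min_poly_radical:
  assumes \<theta>: "\<theta> \<in> T" "\<theta> \<noteq> 0" "w \<theta> = 1" "\<theta> ^ m \<in> K"
  shows "is_min_poly K \<theta> (Polynomial.monom 1 m - [:\<theta> ^ m:])"
  unfolding is_min_poly_def
proof (intro conjI allI impI)
  show "poly_over K (Polynomial.monom 1 m - [:\<theta> ^ m:])"
    using \<theta>(4) by (intro K.poly_over_simps) auto
  have deg: "Polynomial.degree (Polynomial.monom 1 m - [:\<theta> ^ m:]) = m"
  proof -
    have "Polynomial.monom 1 m - [:\<theta> ^ m:] = Polynomial.monom 1 m + [:- (\<theta> ^ m):]"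
      by simp
    then show ?thesis
      using m_pos degree_add_eq_left[of "[:- (\<theta> ^ m):]" "Polynomial.monom 1 m"]
      by (simp only: degree_monom_eq degree_pCons_0 one_neq_zero not_False_eq_True)
  qed
  then show "Polynomial.lead_coeff (Polynomial.monom 1 m - [:\<theta> ^ m:]) = 1"
    using m_pos by (simp add: coeff_pCons split: nat.splits)
  show "poly (Polynomial.monom 1 m - [:\<theta> ^ m:]) \<theta> = 0"
    by (simp add: poly_monom)
  fix g assume g: "poly_over K g \<and> g \<noteq> 0 \<and> poly g \<theta> = 0"
  show "Polynomial.degree (Polynomial.monom 1 m - [:\<theta> ^ m:]) \<le> Polynomial.degree g"
  proof (rule ccontr)
    assume "\<not> ?thesis"
    then have k: "Suc (Polynomial.degree g) \<le> m"
      using deg by simp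
    have "(\<Sum>i<Suc (Polynomial.degree g). Polynomial.coeff g i * \<theta> ^ i) = 0"
      using g by (simp only: poly_altdef lessThan_Suc_atMost)
    then have "\<forall>i<Suc (Polynomial.degree g). Polynomial.coeff g i = 0"
      using combination_zero[of _ "\<lambda>i. \<theta> ^ i", OF uniformizer_basis[OF \<theta>(1-3)] k] g
      by (auto simp: poly_over_def)
    then show False
      using g by auto
  qed
qed

end


section \<open>The residue field\<close>

context valued_field
begin

abbreviation (input) "Ov \<equiv> sub_struct (val_ring F v)"

lemma val_ring_iff: "x \<in> val_ring F v \<longleftrightarrow> x \<in> F \<and> val_ge v 0 x"
  and val_ideal_iff: "x \<in> val_ideal F v \<longleftrightarrow> x \<in> F \<and> val_ge v 1 x"
  by (auto simp: val_ring_def val_ideal_def val_ge_def)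

lemma val_ring_cring: "cring Ov"
proof -
  interpret A: Ring.field "amb :: 'a ring"
    by (rule field_from_type_algebra)
  have "val_ge v 0 (x * y)" if "val_ge v 0 x" "val_ge v 0 y" "x \<in> F" "y \<in> F" for x y
    using val_ge_mult[of 0 x 0 y] that by simp
  then have "subring (val_ring F v) amb"
    unfolding subring_amb_iff by (auto simp: val_ring_iff val_ge_add val_ge_def[of _ _ 1])
  then show ?thesis
    using A.subcringI' A.subcring_iff by auto
qed

lemma val_ideal_maximal: "maximalideal (val_ideal F v) Ov"
proof -
  interpret R: cring Ov
    by (rule val_ring_cring)
  have minus: "\<ominus>\<^bsub>Ov\<^esub> x = - x" if "x \<in> val_ring F v" for x
    by (rule R.minus_equality) (use that in \<open>auto simp: val_ring_iff\<close>)
  have ideal: "ideal (val_ideal F v) Ov"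
  proof (rule idealI)
    show "subgroup (val_ideal F v) (add_monoid Ov)"
    proof (rule R.add.subgroupI)
      show "val_ideal F v \<subseteq> carrier Ov"
        using val_ge_mono[of 1 _ 0] by (auto simp: val_ring_iff val_ideal_iff)
      fix x assume "x \<in> val_ideal F v"
      then show "\<ominus>\<^bsub>Ov\<^esub> x \<in> val_ideal F v"
        using minus[of x] val_ge_mono[of 1 x 0] by (auto simp: val_ring_iff val_ideal_iff)
    next
      show "val_ideal F v \<noteq> {}"
        using val_ideal_iff[of 0] by auto
    qed (auto simp: val_ideal_iff val_ge_add)
    show "x \<otimes>\<^bsub>Ov\<^esub> a \<in> val_ideal F v" "a \<otimes>\<^bsub>Ov\<^esub> x \<in> val_ideal F v"
      if "a \<in> val_ideal F v" "x \<in> carrier Ov" for a x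
      using that val_ge_mult[of 0 x 1 a] by (auto simp: val_ideal_iff val_ring_iff mult.commute)
  qed (rule R.ring_axioms)
  show ?thesis
  proof (rule maximalidealI[OF ideal])
    show "carrier Ov \<noteq> val_ideal F v"
    proof -
      have "1 \<in> val_ring F v" "1 \<notin> val_ideal F v"
        by (auto simp: val_ring_iff val_ideal_iff val_ge_def)
      then show ?thesis by auto
    qed
    fix J assume J: "ideal J Ov" "val_ideal F v \<subseteq> J" "J \<subseteq> carrier Ov"
    show "J = val_ideal F v \<or> J = carrier Ov"
    proof (cases "J \<subseteq> val_ideal F v")
      case False
      then obtain x where x: "x \<in> J" "x \<notin> val_ideal F v" by blast
      have xF: "x \<in> F" "x \<noteq> 0" "v x = 0"
        using x J(3) by (auto simp: val_ring_iff val_ideal_iff val_ge_def)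
      then have "inverse x \<in> carrier Ov"
        by (auto simp: val_ring_iff val_ge_def v_inverse)
      from ideal.I_l_closed[OF J(1) x(1) this] have "1 \<in> J"
        using xF by simp
      then have "x \<in> J" if "x \<in> val_ring F v" for x
        using ideal.I_l_closed[OF J(1), of 1 x] that by simp
      with J(3) show ?thesis by auto
    qed (use J in auto)
  qed
qed

lemma residue_field_field: "Ring.field (residue_field F v)"
  unfolding residue_field_def
  by (rule maximalideal.quotient_is_field[OF val_ideal_maximal val_ring_cring])

definition residue :: "'a \<Rightarrow> 'a set" where
  "residue x = val_ideal F v +>\<^bsub>Ov\<^esub> x"

lemma residue_hom: "residue \<in> ring_hom Ov (residue_field F v)"
  unfolding residue_field_def residue_def[abs_def]
  by (rule ideal.rcos_ring_hom[OF maximalideal.axioms(1)[OF val_ideal_maximal]])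

lemma residue_surj:
  assumes "Y \<in> carrier (residue_field F v)"
  obtains x where "x \<in> val_ring F v" "residue x = Y"
  using assms by (auto simp: residue_field_def FactRing_def A_RCOSETS_def' residue_def)

lemma residue_zero_iff:
  assumes "x \<in> val_ring F v"
  shows "residue x = \<zero>\<^bsub>residue_field F v\<^esub> \<longleftrightarrow> val_ge v 1 x"
proof -
  interpret I: maximalideal "val_ideal F v" Ov
    by (rule val_ideal_maximal)
  have "residue x = val_ideal F v \<longleftrightarrow> x \<in> val_ideal F v"
    unfolding residue_def using assms I.a_rcos_const I.a_rcos_self[of x] by auto
  then show ?thesis
    using assms by (auto simp: residue_field_def FactRing_def val_ideal_iff val_ring_iff)
qed

lemma residue_one_iff:
  assumes "x \<in> val_ring F v"
  shows "residue x = \<one>\<^bsub>residue_field F v\<^esub> \<longleftrightarrow> one_unit x"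
proof -
  interpret Q: Ring.field "residue_field F v"
    by (rule residue_field_field)
  have x1: "x - 1 \<in> val_ring F v" "1 \<in> val_ring F v"
    using assms by (auto simp: val_ring_iff val_ge_def[of _ _ 1] intro!: val_ge_diff)
  have "residue (x - 1 + 1) = residue (x - 1) \<oplus>\<^bsub>residue_field F v\<^esub> residue 1"
    using ring_hom_add[OF residue_hom, of "x - 1" 1] x1 by simp
  also have "residue 1 = \<one>\<^bsub>residue_field F v\<^esub>"
    using ring_hom_one[OF residue_hom] by simp
  finally have "residue x = residue (x - 1) \<oplus>\<^bsub>residue_field F v\<^esub> \<one>\<^bsub>residue_field F v\<^esub>"
    by simp
  moreover have "residue (x - 1) \<in> carrier (residue_field F v)"
    using ring_hom_closed[OF residue_hom, of "x - 1"] x1 by simp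
  ultimately have "residue x = \<one>\<^bsub>residue_field F v\<^esub> \<longleftrightarrow>
      residue (x - 1) = \<zero>\<^bsub>residue_field F v\<^esub>"
    by (metis Q.add.l_cancel_one' Q.l_zero Q.one_closed Q.add.r_cancel_one)
  then show ?thesis
    using residue_zero_iff[OF x1(1)] assms by (auto simp: one_unit_def val_ring_iff)
qed

lemma residue_power:
  assumes "x \<in> val_ring F v"
  shows "x ^ k \<in> val_ring F v" "residue (x ^ k) = residue x [^]\<^bsub>residue_field F v\<^esub> k"
proof -
  interpret R: cring Ov
    by (rule val_ring_cring)
  have pow: "x [^]\<^bsub>Ov\<^esub> k = x ^ k" for k :: nat
    by (induction k) (auto simp: mult.commute)
  show k: "x ^ k \<in> val_ring F v" for k
    using R.nat_pow_closed[of x k] assms pow by simp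
  interpret Q: Ring.field "residue_field F v"
    by (rule residue_field_field)
  show "residue (x ^ k) = residue x [^]\<^bsub>residue_field F v\<^esub> k"
  proof (induction k)
    case 0
    then show ?case
      using ring_hom_one[OF residue_hom] by simp
  next
    case (Suc k)
    then show ?case
      using ring_hom_mult[OF residue_hom, of "x ^ k" x] k assms by (simp add: mult.commute)
  qed
qed

lemma residue_of_nat:
  "residue (of_nat k) = [k] \<cdot>\<^bsub>residue_field F v\<^esub> \<one>\<^bsub>residue_field F v\<^esub>"
proof -
  interpret Q: Ring.field "residue_field F v"
    by (rule residue_field_field)
  have in_ring: "of_nat k \<in> val_ring F v" for k
    by (simp add: val_ring_iff val_ge_of_nat)
  show ?thesis
  proof (induction k)
    case 0
    then show ?case
      using residue_zero_iff[of 0] in_ring[of 0] by simp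
  next
    case (Suc k)
    then show ?case
      using ring_hom_add[OF residue_hom, of "of_nat k" 1] in_ring[of k] in_ring[of 1]
        ring_hom_one[OF residue_hom] by (simp add: add.commute)
  qed
qed

end

section \<open>Roots of unity and the finite residue field\<close>

locale finite_residue_field = valued_field +
  assumes finite_residue_field: "finite (carrier (residue_field F v))"
begin

abbreviation residue_card :: nat where
  "residue_card \<equiv> card (carrier (residue_field F v))"

lemma residue_card_gt_1: "residue_card > 1"
proof -
  interpret Q: Ring.field "residue_field F v"
    by (rule residue_field_field)
  have "card {\<zero>\<^bsub>residue_field F v\<^esub>, \<one>\<^bsub>residue_field F v\<^esub>} \<le> residue_card"
    by (rule card_mono[OF finite_residue_field]) auto
  then show ?thesis by simp
qed

text \<open>The residue field is annihilated by its own cardinality, so \<open>residue_card\<close>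
  lies in the maximal ideal. If \<open>n\<close> did too, Bezout's identity would put 1
  there.\<close>

lemma residual_unit_if_coprime:
  assumes "gcd n residue_card = 1" "n > 0"
  shows "residual_unit n"
proof (rule ccontr)
  interpret Q: Ring.field "residue_field F v"
    by (rule residue_field_field)
  assume "\<not> residual_unit n"
  then have n: "val_ge v 1 (of_nat n)"
    using val_ge_of_nat[of n] by (auto simp: residual_unit_def val_ge_def)
  have "[Coset.order (add_monoid (residue_field F v))] \<cdot>\<^bsub>residue_field F v\<^esub> \<one>\<^bsub>residue_field F v\<^esub>
      = \<zero>\<^bsub>residue_field F v\<^esub>"
    using group.pow_order_eq_1[OF Q.a_group, of "\<one>\<^bsub>residue_field F v\<^esub>"]
    by (simp add: add_pow_def)
  then have "residue (of_nat residue_card) = \<zero>\<^bsub>residue_field F v\<^esub>"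
    by (simp add: residue_of_nat Coset.order_def)
  then have q: "val_ge v 1 (of_nat residue_card)"
    by (subst (asm) residue_zero_iff) (simp_all add: val_ring_iff val_ge_of_nat)
  obtain x y where "n * x = residue_card * y + 1"
    using bezout_nat[of n residue_card] assms by auto
  then have "of_nat n * of_nat x - of_nat residue_card * of_nat y = (1 :: 'a)"
    by (metis add_diff_cancel_left' of_nat_1 of_nat_add of_nat_mult)
  moreover have "val_ge v (1 + 0) (of_nat n * of_nat x)"
      "val_ge v (1 + 0) (of_nat residue_card * of_nat y)"
    by (rule val_ge_mult; simp add: n q val_ge_of_nat)+
  then have "val_ge v 1 (of_nat n * of_nat x - of_nat residue_card * of_nat y)"
    by (intro val_ge_diff) auto
  ultimately show False
    by (simp add: val_ge_def)
qed

text \<open>Lagrange's theorem in the unit group of the residue field, read back through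
  \<open>residue_one_iff\<close>.\<close>

lemma unit_power_one_unit:
  assumes x: "x \<in> F" "x \<noteq> 0" "v x = 0"
  shows "one_unit (x ^ (residue_card - 1))"
proof -
  interpret Q: Ring.field "residue_field F v"
    by (rule residue_field_field)
  have xR: "x \<in> val_ring F v"
    using x by (simp add: val_ring_iff val_ge_def)
  then have "residue x \<in> carrier (Multiplicative_Group.mult_of (residue_field F v))"
    using x ring_hom_closed[OF residue_hom, of x] residue_zero_iff[of x] by (auto simp: val_ge_def)
  then have "residue x [^]\<^bsub>residue_field F v\<^esub> (residue_card - 1) = \<one>\<^bsub>residue_field F v\<^esub>"
    using group.pow_order_eq_1[OF Q.field_mult_group, of "residue x"] finite_residue_field
    by (simp add: Q.order_mult_of Multiplicative_Group.nat_pow_mult_of Coset.order_def)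
  then show ?thesis
    using residue_one_iff[OF residue_power(1)[OF xR]] residue_power(2)[OF xR] by simp
qed

text \<open>The element is a \<open>d\<close>-th root of unity only up to a principal unit;
  \<open>coprime_iff_no_roots_of_unity\<close> corrects it to an exact one.\<close>

lemma residual_root_of_unity_exists:
  assumes d: "d dvd residue_card - 1" "d > 1"
  obtains x where "x \<in> F" "x \<noteq> 0" "v x = 0" "one_unit (x ^ d)" "\<not> one_unit x"
proof -
  let ?Q = "residue_field F v"
  interpret Q: Ring.field ?Q
    by (rule residue_field_field)
  interpret G: group "Multiplicative_Group.mult_of ?Q"
    by (rule Q.field_mult_group)
  obtain g where g: "g \<in> carrier (Multiplicative_Group.mult_of ?Q)"
      "carrier (Multiplicative_Group.mult_of ?Q) = {g [^]\<^bsub>?Q\<^esub> i |i::nat. i \<in> UNIV}"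
    using Q.finite_field_mult_group_has_gen[OF finite_residue_field] by blast
  have order: "Coset.order (Multiplicative_Group.mult_of ?Q) = residue_card - 1"
    using finite_residue_field by (simp add: Q.order_mult_of Coset.order_def)
  have pos: "residue_card - 1 > 0"
    using residue_card_gt_1 by simp
  obtain e where e: "residue_card - 1 = d * e"
    using d(1) by blast
  have "e > 0" "e < residue_card - 1"
    using pos d(2) e by (auto intro: Nat.gr0I)
  \<comment> \<open>With \<open>g\<close> a generator of the cyclic group of order
    \<open>d * e\<close>, its \<open>e\<close>-th power is killed by \<open>d\<close>.\<close>
  define Y where "Y = g [^]\<^bsub>?Q\<^esub> e"
  have Y1: "Y \<noteq> \<one>\<^bsub>?Q\<^esub>"
  proof
    assume Y: "Y = \<one>\<^bsub>?Q\<^esub>"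
    have gQ: "g \<in> carrier ?Q"
      using g(1) by simp
    \<comment> \<open>If \<open>g\<close> to the power \<open>e\<close> were 1, its powers would
      give at most \<open>e\<close> elements, too few for the unit group.\<close>
    have cycle: "g [^]\<^bsub>?Q\<^esub> i \<in> (\<lambda>i. g [^]\<^bsub>?Q\<^esub> i) ` {..<e}" for i :: nat
    proof (rule image_eqI)
      have "g [^]\<^bsub>?Q\<^esub> i = g [^]\<^bsub>?Q\<^esub> (e * (i div e) + i mod e)"
        by simp
      also have "\<dots> = (g [^]\<^bsub>?Q\<^esub> e) [^]\<^bsub>?Q\<^esub> (i div e) \<otimes>\<^bsub>?Q\<^esub> g [^]\<^bsub>?Q\<^esub> (i mod e)"
        by (subst Q.nat_pow_pow[OF gQ], subst Q.nat_pow_mult[OF gQ], rule refl)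
      also have "\<dots> = g [^]\<^bsub>?Q\<^esub> (i mod e)"
        using gQ Y by (simp add: Y_def)
      finally show "g [^]\<^bsub>?Q\<^esub> i = g [^]\<^bsub>?Q\<^esub> (i mod e)" .
    qed (use \<open>e > 0\<close> in auto)
    have sub: "carrier (Multiplicative_Group.mult_of ?Q) \<subseteq> (\<lambda>i. g [^]\<^bsub>?Q\<^esub> i) ` {..<e}"
    proof
      fix Z assume "Z \<in> carrier (Multiplicative_Group.mult_of ?Q)"
      then obtain i :: nat where "Z = g [^]\<^bsub>?Q\<^esub> i"
        unfolding g(2) by blast
      with cycle show "Z \<in> (\<lambda>i. g [^]\<^bsub>?Q\<^esub> i) ` {..<e}"
        by (simp only:)
    qed
    have "card (carrier (Multiplicative_Group.mult_of ?Q)) \<le> e"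
      using surj_card_le[OF finite_lessThan sub] by (simp only: card_lessThan)
    then show False
      using order \<open>e < residue_card - 1\<close> unfolding Coset.order_def by linarith
  qed
  have Yd: "Y [^]\<^bsub>?Q\<^esub> d = \<one>\<^bsub>?Q\<^esub>"
  proof -
    have "Y [^]\<^bsub>?Q\<^esub> d = g [^]\<^bsub>?Q\<^esub> Coset.order (Multiplicative_Group.mult_of ?Q)"
      using g(1) order e by (simp add: Y_def Q.nat_pow_pow mult.commute)
    also have "\<dots> = \<one>\<^bsub>?Q\<^esub>"
      using G.pow_order_eq_1[OF g(1)] by (simp add: Multiplicative_Group.nat_pow_mult_of)
    finally show ?thesis .
  qed
  have YQ: "Y \<in> carrier ?Q"
    using g(1) by (simp add: Y_def)
  then obtain x where x: "x \<in> val_ring F v" "residue x = Y"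
    using residue_surj by blast
  have "Y \<noteq> \<zero>\<^bsub>?Q\<^esub>"
    using Yd d(2) by (auto simp: Q.nat_pow_zero)
  then have "\<not> val_ge v 1 x"
    using residue_zero_iff x by blast
  then have "x \<in> F" "x \<noteq> 0" "v x = 0"
    using x(1) by (auto simp: val_ring_iff val_ge_def)
  moreover have "one_unit (x ^ d)" "\<not> one_unit x"
    using residue_one_iff[OF residue_power(1)[OF x(1)]] residue_one_iff[OF x(1)]
      residue_power(2)[OF x(1)] x(2) Y1 Yd by auto
  ultimately show ?thesis
    using that by blast
qed

theorem coprime_iff_no_roots_of_unity:
  assumes complete: val_complete and n: "gcd n residue_card = 1" "n > 0"
  shows "gcd n (residue_card - 1) = 1 \<longleftrightarrow> (\<forall>z\<in>F. z ^ n = 1 \<longrightarrow> z = 1)"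
proof
  note unit = residual_unit_if_coprime[OF n]
  assume gcd: "gcd n (residue_card - 1) = 1"
  show "\<forall>z\<in>F. z ^ n = 1 \<longrightarrow> z = 1"
  proof (intro ballI impI)
    fix z assume z: "z \<in> F" "z ^ n = 1"
    obtain x y where xy: "n * x = (residue_card - 1) * y + 1"
      using bezout_nat[of n "residue_card - 1"] gcd n(2) by auto
    have "1 = z ^ (n * x)"
      using z(2) by (simp add: power_mult)
    also have "\<dots> = (z ^ (residue_card - 1)) ^ y * z"
      by (simp add: xy power_add power_mult)
    \<comment> \<open>By Bezout, \<open>z\<close> is a power of the principal unit
      \<open>z ^ (residue_card - 1)\<close>, so it is a torsion principal unit.\<close>
    finally have "inverse ((z ^ (residue_card - 1)) ^ y) = z"
      by (intro inverse_unique) simp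
    moreover have "one_unit (inverse ((z ^ (residue_card - 1)) ^ y))"
      using root_of_unity_v[OF z n(2)] z(1)
      by (intro one_unit_inverse one_unit_power unit_power_one_unit)
    ultimately show "z = 1"
      using one_unit_torsion[OF _ z(2) unit] by simp
  qed
next
  note unit = residual_unit_if_coprime[OF n]
  assume no: "\<forall>z\<in>F. z ^ n = 1 \<longrightarrow> z = 1"
  show "gcd n (residue_card - 1) = 1"
  proof (rule ccontr)
    assume "gcd n (residue_card - 1) \<noteq> 1"
    then have "gcd n (residue_card - 1) > 1"
      using n(2) by (metis gcd_pos_nat less_one nat_neq_iff)
    then obtain d where d: "d dvd n" "d dvd residue_card - 1" "d > 1"
      by (metis gcd_dvd1 gcd_dvd2)
    obtain x where x: "x \<in> F" "x \<noteq> 0" "v x = 0" "one_unit (x ^ d)" "\<not> one_unit x"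
      using residual_root_of_unity_exists[OF d(2,3)] .
    \<comment> \<open>\<open>x\<close> and \<open>y\<close> have the same \<open>d\<close>-th power,
      but only \<open>y\<close> is a principal unit; hence \<open>x / y\<close> is a nontrivial root
      of unity.\<close>
    obtain y where y: "one_unit y" "y ^ d = x ^ d"
      using one_unit_root_exists[OF complete residual_unit_dvd[OF unit d(1)] x(4)] .
    have "(x / y) ^ d = 1"
      using x(2) y(2) by (simp add: power_divide)
    then have "(x / y) ^ n = 1"
      using d(1) by (auto simp: power_mult)
    then have "x / y = 1"
      using no x(1) one_unitD(1)[OF y(1)] by blast
    then have "x = y"
      using one_unitD(3)[OF y(1)] by simp
    with x(5) y(1) show False by simp
  qed
qed

end


section \<open>Tamely and totally ramified extensions inside a Galois extension\<close>

lemma totally_ramifiedE: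
  assumes K: "valued_field K v" and T: "totally_ramified K v T"
  obtains w where "totally_ramified_ext K v T w (ext_degree K T)"
proof -
  interpret A: Ring.field "amb :: 'a ring"
    by (rule field_from_type_algebra)
  interpret K: valued_field K v by fact
  have fin: "field_ext K T" "A.finite_dimension K T"
    using T by (auto simp: totally_ramified_def finite_ext_def)
  obtain w where w: "discrete_valuation T w" "val_over K v w (ext_degree K T)"
    using T by (auto simp: totally_ramified_def)
  have "ring.dimension amb (ext_degree K T) K T"
    using A.finite_dimensionE[OF K.subfield_amb fin(2)] by (simp add: ext_degree_def over_def)
  then have "totally_ramified_ext K v T w (ext_degree K T)"
    using w field_extD(2,3)[OF fin(1)] K
    by (auto simp: totally_ramified_ext_def totally_ramified_ext_axioms_def valued_field_def
        valued_field_axioms_def val_over_def)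
  with that show ?thesis by blast
qed

lemma compositum_superset: "L \<union> L' \<subseteq> compositum L L'" for L :: "'a::field set"
proof -
  interpret A: Ring.field "amb :: 'a ring"
    by (rule field_from_type_algebra)
  show ?thesis
    unfolding compositum_def by (rule A.generate_fieldE(2)[OF _ refl]) simp
qed

lemma compositum_absorb:
  fixes L :: "'a::field set"
  assumes "subfield L amb" "L' \<subseteq> L"
  shows "compositum L L' = L"
proof -
  interpret A: Ring.field "amb :: 'a ring"
    by (rule field_from_type_algebra)
  have "compositum L L' \<subseteq> L"
    unfolding compositum_def using assms by (intro A.generate_field_min_subfield1) auto
  then show ?thesis
    using compositum_superset[of L L'] by auto
qed

text \<open>Take \<open>d\<close> to be the order of \<open>z\<close>. Its first \<open>d\<close>
  powers are distinct roots of \<open>X ^ d - 1\<close>, which has at most \<open>d\<close>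
  roots.\<close>

lemma roots_of_unity_are_powers:
  fixes z :: "'a::field"
  assumes "z ^ n = 1" "n > 0"
  obtains d where "d > 0" "d dvd n" "z ^ d = 1" "d = 1 \<longleftrightarrow> z = 1" "\<And>x. x ^ d = 1 \<Longrightarrow> \<exists>i. x = z ^ i"
proof -
  define d where "d = (LEAST d. d > 0 \<and> z ^ d = 1)"
  have d: "d > 0" "z ^ d = 1"
    using LeastI[of "\<lambda>d. d > 0 \<and> z ^ d = 1" n] assms by (auto simp: d_def)
  have min: "d \<le> k" if "k > 0" "z ^ k = 1" for k
    unfolding d_def using that by (intro Least_le) auto
  have "z ^ n = (z ^ d) ^ (n div d) * z ^ (n mod d)"
    by (simp flip: power_mult power_add)
  then have "z ^ (n mod d) = 1"
    using d assms by simp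
  then have "d dvd n"
    using min[of "n mod d"] d(1) by (meson dvd_eq_mod_eq_0 gr0I mod_less_divisor not_less)
  have z0: "z \<noteq> 0"
    using d by (auto simp: power_0_left)
  have inj: "inj_on (\<lambda>i. z ^ i) {..<d}"
  proof (rule linorder_inj_onI')
    fix i j assume ij: "i \<in> {..<d}" "j \<in> {..<d}" "i < j"
    show "z ^ i \<noteq> z ^ j"
    proof
      assume "z ^ i = z ^ j"
      moreover have "z ^ j = z ^ i * z ^ (j - i)"
        using ij(3) by (simp flip: power_add)
      ultimately have "z ^ (j - i) = 1"
        using z0 by simp
      then show False
        using min[of "j - i"] ij by auto
    qed
  qed
  define p where "p = Polynomial.monom (1 :: 'a) d - 1"
  have "Polynomial.coeff p d = 1"
    using d(1) by (simp add: p_def)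
  then have "p \<noteq> 0"
    by auto
  have "Polynomial.degree p \<le> d"
    unfolding p_def by (intro degree_diff_le) (auto simp: degree_monom_le)
  then have fin: "finite {x :: 'a. x ^ d = 1}" "card {x :: 'a. x ^ d = 1} \<le> d"
    using poly_roots_finite[OF \<open>p \<noteq> 0\<close>] card_poly_roots_bound[OF \<open>p \<noteq> 0\<close>]
    by (auto simp: p_def poly_monom)
  have powers: "(\<lambda>i. z ^ i) ` {..<d} = {x :: 'a. x ^ d = 1}"
  proof (rule card_subset_eq[OF fin(1)])
    show sub: "(\<lambda>i. z ^ i) ` {..<d} \<subseteq> {x :: 'a. x ^ d = 1}"
      using d(2) by (auto simp flip: power_mult simp: mult.commute[of _ d]) (simp add: power_mult)
    show "card ((\<lambda>i. z ^ i) ` {..<d}) = card {x :: 'a. x ^ d = 1}"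
      using card_mono[OF fin(1) sub] fin(2) card_image[OF inj] by simp
  qed
  show ?thesis
  proof (rule that[OF d(1) \<open>d dvd n\<close> d(2)])
    show "d = 1 \<longleftrightarrow> z = 1"
      using d min[of 1] by auto
    show "\<exists>i. x = z ^ i" if "x ^ d = 1" for x
    proof -
      have "x \<in> (\<lambda>i. z ^ i) ` {..<d}"
        unfolding powers using that by simp
      then show ?thesis by auto
    qed
  qed
qed

lemma degree_prod_linear_factors:
  "Polynomial.degree (\<Prod>r\<leftarrow>rs. [:- r, 1:]) = length rs" for rs :: "'a::field list"
proof (induction rs)
  case (Cons r rs)
  have "(\<Prod>r\<leftarrow>rs. [:- r, 1:]) \<noteq> 0"
    by (auto simp: prod_list_zero_iff)
  with Cons show ?case
    by (simp add: degree_mult_eq del: mult_pCons_left)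
qed auto

text \<open>If \<open>t\<close> were the only root, it would be a multiple one, but the derivative
  at \<open>t\<close> is \<open>m * t ^ (m - 1)\<close>, which is nonzero.\<close>

lemma binomial_root_other:
  fixes t :: "'a::field"
  assumes "Polynomial.monom 1 m - [:t ^ m:] = (\<Prod>r\<leftarrow>rs. [:- r, 1:])"
    and "(of_nat m :: 'a) \<noteq> 0" "t \<noteq> 0" "m > 1"
  obtains r where "r \<in> set rs" "r \<noteq> t" "r ^ m = t ^ m"
proof -
  let ?p = "Polynomial.monom 1 m - [:t ^ m:]"
  have root: "r ^ m = t ^ m" if "r \<in> set rs" for r
  proof -
    have "poly ?p r = 0"
      unfolding assms(1) using that by (simp only: prod_list_root_iff)
    then show ?thesis
      by (simp add: poly_monom)
  qed
  have "\<not> set rs \<subseteq> {t}"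
  proof
    assume rs: "set rs \<subseteq> {t}"
    have "Polynomial.degree ?p \<ge> m"
      using assms(4) by (intro le_degree) (auto simp: coeff_pCons split: nat.splits)
    then have "length rs \<ge> 2"
      using assms(4) unfolding assms(1) by (simp add: degree_prod_linear_factors)
    then obtain r1 r2 rs' where "rs = r1 # r2 # rs'"
      by (metis Suc_le_length_iff numeral_2_eq_2)
    with rs have "?p = [:- t, 1:] * ([:- t, 1:] * (\<Prod>r\<leftarrow>rs'. [:- r, 1:]))"
      unfolding assms(1) by simp
    from arg_cong[OF this, of "\<lambda>p. poly (pderiv p) t"] have "poly (pderiv ?p) t = 0"
      by (simp only: pderiv_mult poly_add poly_mult) simp
    then have "of_nat m * t ^ (m - 1) = 0"
      by (simp add: pderiv_diff pderiv_monom pderiv_pCons poly_monom)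
    then show False
      using assms(2,3) by simp
  qed
  with root that show ?thesis by blast
qed

section \<open>The action of the Galois group on a radical uniformizer\<close>

locale tame_galois = totally_ramified_ext K v L w n + normal_extension K N
  for K :: "'a::field set" and v and L :: "'a set" and w n and N :: "'a set" +
  fixes \<theta> :: 'a
  assumes galois: "galois_ext K N" and L_sub_N: "L \<subseteq> N"
    and complete: "K.val_complete" and tame: "K.residual_unit n"
    and uniformizer: "\<theta> \<in> L" "\<theta> \<noteq> 0" "w \<theta> = 1" and radical: "\<theta> ^ n \<in> K"
begin

lemma conjugate:
  assumes "\<sigma> \<in> Gal N K"
  shows "\<sigma> \<theta> \<in> N" "\<sigma> \<theta> ^ n = \<theta> ^ n" "\<sigma> \<theta> \<noteq> 0" "(\<sigma> \<theta> / \<theta>) ^ n = 1"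
proof -
  interpret \<sigma>: galois_automorphism K N \<sigma>
    using assms by (rule galois_automorphismI)
  have N: "\<theta> \<in> N"
    using uniformizer L_sub_N by auto
  then show "\<sigma> \<theta> \<in> N" by auto
  show *: "\<sigma> \<theta> ^ n = \<theta> ^ n"
    using \<sigma>.power[OF N, of n] \<sigma>.fixed[OF radical] by simp
  then show "\<sigma> \<theta> \<noteq> 0"
    using uniformizer(2) m_pos by (auto simp: power_0_left)
  show "(\<sigma> \<theta> / \<theta>) ^ n = 1"
    using * uniformizer(2) by (simp add: power_divide)
qed

lemma automorphism_on_L:
  assumes "\<sigma> \<in> Gal N K" "x \<in> L"
  obtains c where "\<And>i. c i \<in> K" "x = (\<Sum>i<n. c i * \<theta> ^ i)" "\<sigma> x = (\<Sum>i<n. c i * \<sigma> \<theta> ^ i)"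
proof -
  interpret \<sigma>: galois_automorphism K N \<sigma>
    using assms(1) by (rule galois_automorphismI)
  obtain c where c: "\<And>i. c i \<in> K" "x = (\<Sum>i<n. c i * \<theta> ^ i)"
    using basis[of "\<lambda>i. \<theta> ^ i", OF uniformizer_basis[OF uniformizer] assms(2)] by blast
  have "\<theta> \<in> N" "\<And>i. c i \<in> N"
    using uniformizer c L_sub_N K_sub_N by auto
  then have "\<sigma> x = (\<Sum>i<n. c i * \<sigma> \<theta> ^ i)"
    unfolding c(2) using c(1) by (subst \<sigma>.sum) (auto simp: \<sigma>.mult \<sigma>.power N.power N.mult)
  with c that show ?thesis by blast
qed

lemma nontrivial_on_L:
  assumes "\<sigma> \<in> Gal N K - Gal N L"
  shows "\<sigma> \<theta> \<noteq> \<theta>"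
proof
  assume fix_\<theta>: "\<sigma> \<theta> = \<theta>"
  have "\<sigma> x = x" if "x \<in> L" for x
    using automorphism_on_L[of \<sigma> x] assms that fix_\<theta> by auto
  then show False
    using assms Gal_mono[of \<sigma> N K L] by blast
qed

lemma compositum_not_totally_ramified:
  assumes no: "\<forall>z\<in>K. z ^ n = 1 \<longrightarrow> z = 1" and \<sigma>: "\<sigma> \<in> Gal N K - Gal N L"
  shows "\<not> totally_ramified K v (compositum L (\<sigma> ` L))"
proof
  assume "totally_ramified K v (compositum L (\<sigma> ` L))"
  then obtain w' where
    "totally_ramified_ext K v (compositum L (\<sigma> ` L)) w' (ext_degree K (compositum L (\<sigma> ` L)))"
    using totally_ramifiedE K.valued_field_axioms by blast
  then interpret C: totally_ramified_ext K v "compositum L (\<sigma> ` L)" w'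
    "ext_degree K (compositum L (\<sigma> ` L))" .
  have "\<sigma> \<theta> / \<theta> \<in> compositum L (\<sigma> ` L)"
    using compositum_superset[of L "\<sigma> ` L"] uniformizer(1) by (intro C.T.divide) auto
  then have "\<sigma> \<theta> / \<theta> \<in> K"
    using C.root_of_unity_in_base[OF complete tame] conjugate(4) \<sigma> by blast
  then have "\<sigma> \<theta> / \<theta> = 1"
    using no conjugate(4) \<sigma> by blast
  then show False
    using nontrivial_on_L[OF \<sigma>] uniformizer(2) by simp
qed

text \<open>Such a \<open>\<sigma>\<close> refutes exceptionality, since the compositum collapses to
  \<open>L\<close>, which is totally ramified. It exists because \<open>z * \<theta>\<close> is a
  root of the minimal polynomial of \<open>\<theta>\<close>, and it preserves \<open>L\<close>
  because \<open>z\<close> lies in \<open>K\<close>.\<close>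

lemma automorphism_preserving_L:
  assumes z: "z \<in> K" "z ^ n = 1" "z \<noteq> 1"
  obtains \<sigma> where "\<sigma> \<in> Gal N K - Gal N L" "compositum L (\<sigma> ` L) = L"
proof -
  have z\<theta>: "z * \<theta> \<in> L" "\<theta> \<in> N" "z * \<theta> \<in> N"
    using z uniformizer L_sub_N by auto
  obtain \<sigma> where \<sigma>: "\<sigma> \<in> Gal N K" "\<sigma> \<theta> = z * \<theta>"
  proof (rule conjugate_by_Gal[OF z\<theta>(2) _ z\<theta>(3)])
    show "is_min_poly K \<theta> (Polynomial.monom 1 n - [:\<theta> ^ n:])"
      by (rule is_min_poly_radical[OF uniformizer radical])
    show "poly (Polynomial.monom 1 n - [:\<theta> ^ n:]) (z * \<theta>) = 0"
      using z(2) by (simp add: poly_monom power_mult_distrib)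
  qed
  have "\<sigma> \<notin> Gal N L"
    using GalD(4)[of \<sigma> N L \<theta>] \<sigma>(2) uniformizer z(3) by auto
  moreover have "\<sigma> ` L \<subseteq> L"
  proof safe
    fix x assume "x \<in> L"
    then obtain c where c: "\<And>i. c i \<in> K" "\<sigma> x = (\<Sum>i<n. c i * \<sigma> \<theta> ^ i)"
      using automorphism_on_L[OF \<sigma>(1)] by metis
    then show "\<sigma> x \<in> L"
      using z\<theta>(1) K_in_T unfolding \<sigma>(2) by (auto intro!: T.sum T.mult T.power)
  qed
  then have "compositum L (\<sigma> ` L) = L"
    by (rule compositum_absorb[OF T.subfield_amb])
  ultimately show ?thesis
    using that \<sigma>(1) by blast
qed

text \<open>Let \<open>d\<close> be the order of \<open>z\<close> and \<open>k = n / d\<close>. Then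
  \<open>\<sigma> (\<theta> ^ k) / \<theta> ^ k\<close> is a \<open>d\<close>-th root of unity,
  hence a power of \<open>z\<close> and in \<open>K\<close>. Taking the stable core of
  \<open>L\<close> for \<open>M\<close> makes it Galois at once; the power
  \<open>\<theta> ^ k\<close> serves as a witness for \<open>M \<noteq> K\<close>, as its value
  \<open>k\<close> is not a multiple of \<open>n\<close>.\<close>

lemma kummer_subextension:
  assumes z: "z \<in> K" "z ^ n = 1" "z \<noteq> 1"
  shows "\<exists>M. subfield M amb \<and> K \<subseteq> M \<and> M \<subseteq> L \<and> M \<noteq> K \<and> galois_ext K M"
proof -
  obtain d where d: "d > 0" "d dvd n" "z ^ d = 1" "d = 1 \<longleftrightarrow> z = 1"
    and roots: "\<And>x. x ^ d = 1 \<Longrightarrow> \<exists>i. x = z ^ i"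
    using roots_of_unity_are_powers[OF z(2) m_pos] by metis
  obtain k where k: "n = k * d"
    using d(2) by (metis dvd_div_mult_self)
  have k_bounds: "0 < k" "k < n"
    using k m_pos d(1,4) z(3) by (auto intro: Nat.gr0I)
  define M where "M = {x \<in> L. \<forall>\<sigma>\<in>Gal N K. \<sigma> x \<in> L}"
  note M = galois_ext_stable_core[OF galois T.subfield_amb K_sub_T L_sub_N, folded M_def]
  have \<theta>k: "\<theta> ^ k \<in> L" "\<theta> ^ k \<noteq> 0" "w (\<theta> ^ k) = int k" "\<theta> \<in> N"
    using uniformizer_basis[OF uniformizer] uniformizer L_sub_N by auto
  have "\<sigma> (\<theta> ^ k) \<in> L" if \<sigma>: "\<sigma> \<in> Gal N K" for \<sigma>
  proof -
    interpret \<sigma>: galois_automorphism K N \<sigma>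
      using \<sigma> by (rule galois_automorphismI)
    have "(\<sigma> (\<theta> ^ k) / \<theta> ^ k) ^ d = (\<sigma> \<theta> / \<theta>) ^ n"
      unfolding k power_mult \<sigma>.power[OF \<theta>k(4)] by (simp add: power_divide)
    then obtain i where "\<sigma> (\<theta> ^ k) / \<theta> ^ k = z ^ i"
      using roots conjugate(4)[OF \<sigma>] by metis
    then have "\<sigma> (\<theta> ^ k) = z ^ i * \<theta> ^ k"
      using \<theta>k(2) by (simp add: field_simps)
    then show ?thesis
      using z(1) \<theta>k(1) by (auto intro!: T.mult T.power)
  qed
  then have "\<theta> ^ k \<in> M"
    using \<theta>k(1) by (simp add: M_def)
  moreover have "\<theta> ^ k \<notin> K"
  proof
    assume "\<theta> ^ k \<in> K"
    then have "int k = int n * v (\<theta> ^ k)"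
      using w_K \<theta>k by metis
    then have "int n dvd int k"
      by simp
    then show False
      using k_bounds by (auto dest: zdvd_imp_le)
  qed
  ultimately have "M \<noteq> K" by blast
  with M show ?thesis
    by (intro exI[of _ M]) (auto simp: M_def)
qed

end

section \<open>Galois subextensions of a totally ramified extension\<close>

context totally_ramified_ext
begin

text \<open>
  If \<open>y\<close> generates the value group \<open>g * \<int>\<close> of \<open>M\<close>, then the products \<open>y ^ j * \<theta> ^ i\<close> with \<open>i < g\<close>
  form a basis of \<open>T\<close> over \<open>K\<close>, and for reasons of value only those with \<open>i = 0\<close> occur in \<open>M\<close>.
\<close>

lemma intermediate_totally_ramified:
  assumes M: "subfield M amb" "K \<subseteq> M" "M \<subseteq> T" "M \<noteq> K"
  obtains u k where "totally_ramified_ext K v M u k" "k dvd m" "k > 1"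
proof -
  interpret M: subfld M
    using M(1) by (rule subfld.intro)
  have wM: "w (x * y) = w x + w y" "w (x powi k) = k * w x"
    if "x \<in> M" "y \<in> M" "x \<noteq> 0" "y \<noteq> 0" for x y k
    using that M(3) by (auto simp: T.v_mult T.v_power_int subset_iff)
  \<comment> \<open>The least positive value on \<open>M\<close> generates its value group;
    \<open>m / g\<close> turns out to be both the degree and the ramification index of
    \<open>M\<close>.\<close>
  define P where "P k \<longleftrightarrow> k > 0 \<and> (\<exists>x\<in>M. x \<noteq> 0 \<and> w x = int k)" for k
  define g where "g = (LEAST k. P k)"
  obtain \<pi> where \<pi>: "\<pi> \<in> K" "\<pi> \<noteq> 0" "v \<pi> = 1"
    using K.surj[of 1] by blast
  have "P m"
    unfolding P_def using m_pos M(2) \<pi> by (intro conjI bexI[of _ \<pi>]) (auto simp: w_K)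
  then have "P g"
    unfolding g_def by (rule LeastI)
  then obtain y where y: "y \<in> M" "y \<noteq> 0" "w y = int g" and g_pos: "g > 0"
    by (auto simp: P_def)
  have g_dvd: "int g dvd w x" if x: "x \<in> M" "x \<noteq> 0" for x
  proof (rule ccontr)
    assume "\<not> int g dvd w x"
    then have r: "0 < w x mod int g" "w x mod int g < int g"
      using g_pos pos_mod_sign[of "int g" "w x"] pos_mod_bound[of "int g" "w x"]
      by (auto simp: dvd_eq_mod_eq_0)
    have yk: "y powi (- (w x div int g)) \<in> M" "y powi (- (w x div int g)) \<noteq> 0"
      using y by auto
    have "w (x * y powi (- (w x div int g))) = w x - w x div int g * int g"
      using wM(1)[OF x(1) yk(1) x(2) yk(2)] wM(2)[OF y(1,1,2,2)] y(3) by simp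
    then have "w (x * y powi (- (w x div int g))) = w x mod int g"
      by (simp add: minus_div_mult_eq_mod)
    then have "P (nat (w x mod int g))"
      unfolding P_def using r x yk by (intro conjI bexI[of _ "x * y powi (- (w x div int g))"]) auto
    then have "g \<le> nat (w x mod int g)"
      unfolding g_def by (rule Least_le)
    with r show False by simp
  qed
  have "int g dvd int m"
    using g_dvd[of \<pi>] \<pi> M(2) w_K[of \<pi>] by auto
  then obtain k where k: "m = g * k"
    by auto
  have "k > 0"
    using k m_pos by (auto intro: Nat.gr0I)
  obtain \<theta> where \<theta>: "\<theta> \<in> T" "\<theta> \<noteq> 0" "w \<theta> = 1"
    using T.surj[of 1] by blast
  \<comment> \<open>Division with remainder gives \<open>b i\<close> the value exactly
    \<open>i\<close>, as \<open>basis\<close> requires.\<close>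
  define b where "b i = y ^ (i div g) * \<theta> ^ (i mod g)" for i
  have b: "b i \<in> T \<and> b i \<noteq> 0 \<and> w (b i) = int i" for i
  proof -
    have "int (i div g) * int g + int (i mod g) = int i"
      by (simp flip: of_nat_mult of_nat_add)
    then show ?thesis
      using y M(3) \<theta> by (auto simp: b_def T.v_mult T.v_power T.mult T.power subset_iff)
  qed
  \<comment> \<open>At an index \<open>g * j\<close> the basis element is just \<open>y ^ j\<close>;
    this carries independence and spanning over to the powers of \<open>y\<close>.\<close>
  have reindex: "(\<Sum>i<m. (if g dvd i then c i else 0) * b i) = (\<Sum>j<k. c (g * j) * y ^ j)" for c
  proof -
    have "(\<Sum>i<m. (if g dvd i then c i else 0) * b i) =
        (\<Sum>i\<in>(\<lambda>j. g * j) ` {..<k}. (if g dvd i then c i else 0) * b i)"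
    proof (rule sum.mono_neutral_right)
      show "(\<lambda>j. g * j) ` {..<k} \<subseteq> {..<m}"
        using k g_pos by auto
      show "\<forall>i\<in>{..<m} - (\<lambda>j. g * j) ` {..<k}. (if g dvd i then c i else 0) * b i = 0"
        using k g_pos by (auto elim!: dvdE)
    qed auto
    also have "\<dots> = (\<Sum>j<k. (if g dvd g * j then c (g * j) else 0) * b (g * j))"
      using g_pos by (subst sum.reindex) (auto simp: inj_on_def)
    also have "\<dots> = (\<Sum>j<k. c (g * j) * y ^ j)"
      using g_pos by (simp add: b_def)
    finally show ?thesis .
  qed
  have yM: "(\<Sum>j<k. c j * y ^ j) \<in> M" if "\<And>j. c j \<in> K" for c
    using that y(1) M(2) by (intro M.sum M.mult M.power) auto
  have dim: "ring.dimension amb k K M"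
  proof (rule K.dimension_ambI)
    fix c assume c: "\<And>j. j < k \<Longrightarrow> c j \<in> K" "(\<Sum>j<k. c j * y ^ j) = 0"
    have "\<forall>i<m. (if g dvd i then c (i div g) else 0) = 0"
    proof (rule combination_zero[OF b order_refl])
      show "(\<Sum>i<m. (if g dvd i then c (i div g) else 0) * b i) = 0"
        using reindex[of "\<lambda>i. c (i div g)"] c(2) g_pos by simp
      show "(if g dvd i then c (i div g) else 0) \<in> K" if "i < m" for i
        using that c(1)[of "i div g"] k g_pos by (auto simp: less_mult_imp_div_less mult.commute)
    qed
    then show "\<forall>j<k. c j = 0"
    proof (intro allI impI)
      fix j assume "j < k"
      then have "g * j < m"
        using k g_pos by simp
      then show "c j = 0"
        using \<open>\<forall>i<m. (if g dvd i then c (i div g) else 0) = 0\<close> g_pos by fastforce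
    qed
  next
    fix x assume x: "x \<in> M"
    then obtain c where c: "\<And>i. c i \<in> K" "x = (\<Sum>i<m. c i * b i)"
      using basis[of b x, OF b] M(3) by auto
    define s where "s = (\<Sum>j<k. c (g * j) * y ^ j)"
    define c' where "c' i = (if g dvd i then 0 else c i)" for i
    have diff: "x - s = (\<Sum>i<m. c' i * b i)"
      unfolding s_def reindex[symmetric] c(2) sum_subtractf[symmetric]
      by (intro sum.cong) (auto simp: c'_def)
    \<comment> \<open>The difference lies in \<open>M\<close>, so its value would be a multiple of
      \<open>g\<close>; but its dominant term has an index not divisible by \<open>g\<close>, and
      \<open>g\<close> divides \<open>m\<close>.\<close>
    have "x - s = 0"
    proof (rule ccontr)
      assume nz: "x - s \<noteq> 0"
      have ex: "\<exists>i<m. c' i \<noteq> 0"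
      proof (rule ccontr)
        assume "\<not> ?thesis"
        then have "(\<Sum>i<m. c' i * b i) = 0" by simp
        with nz diff show False by simp
      qed
      have c'K: "c' i \<in> K" for i
        using c(1) by (simp add: c'_def)
      obtain j where j: "c' j \<noteq> 0" "w (x - s) = int m * v (c' j) + int j"
        using dominant_term(2)[OF b order_refl c'K ex] diff by auto
      have "x - s \<in> M"
        unfolding s_def using x yM c(1) by (intro M.diff) auto
      then have "int g dvd int m * v (c' j) + int j"
        using g_dvd nz j(2) by metis
      moreover have "int g dvd int m * v (c' j)"
        unfolding k by simp
      ultimately have "g dvd j"
        by (simp add: dvd_add_right_iff)
      with j(1) show False
        by (simp add: c'_def)
    qed
    then show "\<exists>c. (\<forall>i. c i \<in> K) \<and> x = (\<Sum>j<k. c j * y ^ j)"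
      using c(1) by (intro exI[of _ "\<lambda>j. c (g * j)"]) (auto simp: s_def)
  qed (use yM in auto)
  \<comment> \<open>This renormalises \<open>w\<close> on \<open>M\<close>; by \<open>g_dvd\<close>
    the division is exact on nonzero elements.\<close>
  define u where "u x = w x div int g" for x
  have "discrete_valuation M u"
    unfolding discrete_valuation_def
  proof (intro conjI ballI impI)
    fix x y assume xy: "x \<in> M - {0}" "y \<in> M - {0}"
    then show "u (x * y) = u x + u y"
      unfolding u_def using wM(1) g_dvd by (simp add: div_plus_div_distrib_dvd_left)
    assume "x + y \<noteq> 0"
    then have "min (w x) (w y) \<le> w (x + y)"
      using T.discrete_valuation xy M(3) unfolding discrete_valuation_def subset_iff by blast
    then show "min (u x) (u y) \<le> u (x + y)"
      unfolding u_def using g_pos by (auto simp: min_le_iff_disj intro: zdiv_mono1)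
  next
    have "u (y powi k) = k" for k
      using wM(2)[OF y(1,1,2,2)] y(3) g_pos by (simp add: u_def)
    moreover have "y powi k \<in> M - {0}" for k
      using y by auto
    ultimately show "u ` (M - {0}) = UNIV"
      by (metis UNIV_eq_I image_eqI)
  qed
  moreover have "u x = int k * v x" if "x \<in> K" "x \<noteq> 0" for x
    using that g_pos by (simp add: u_def w_K k)
  ultimately have "totally_ramified_ext K v M u k"
    using M(2) dim \<open>k > 0\<close> K.valued_field_axioms M.subfld_axioms
    by (auto simp: totally_ramified_ext_def totally_ramified_ext_axioms_def valued_field_def
        valued_field_axioms_def)
  moreover have "k \<noteq> 1"
  proof
    assume "k = 1"
    have "M \<subseteq> K"
    proof
      fix x assume "x \<in> M"
      then obtain c where "\<And>i. c i \<in> K" "x = (\<Sum>j<k. c j * y ^ j)"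
        using K.independent_spans[OF dim, of "\<lambda>j. y ^ j" x] y(1) \<open>k = 1\<close> y(2) by auto
      then show "x \<in> K"
        using \<open>k = 1\<close> by simp
    qed
    with M show False by auto
  qed
  ultimately show ?thesis
    using that k \<open>k > 0\<close> by (metis dvd_triv_right nat_neq_iff less_one)
qed

text \<open>Normality splits \<open>X ^ m - \<theta> ^ m\<close> in \<open>T\<close>, and tameness
  provides a root other than \<open>\<theta>\<close>. The quotient of the two is a root of unity of
  \<open>T\<close>, which already lies in \<open>K\<close>.\<close>

lemma galois_root_of_unity:
  assumes complete: "K.val_complete" and tame: "K.residual_unit m" and "m > 1"
    and normal: "normal_ext K T"
  obtains z where "z \<in> K" "z ^ m = 1" "z \<noteq> 1"
proof -
  obtain \<theta> where \<theta>: "\<theta> \<in> T" "\<theta> \<noteq> 0" "w \<theta> = 1" "\<theta> ^ m \<in> K"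
    using tame_radical_uniformizer[OF complete tame] .
  interpret T: normal_extension K T
    using normal by (rule normal_extensionI)
  obtain rs where rs: "set rs \<subseteq> T" "Polynomial.monom 1 m - [:\<theta> ^ m:] = (\<Prod>r\<leftarrow>rs. [:- r, 1:])"
    using T.min_poly_splits[OF is_min_poly_radical[OF \<theta>] \<theta>(1)] .
  obtain r where r: "r \<in> set rs" "r \<noteq> \<theta>" "r ^ m = \<theta> ^ m"
    using binomial_root_other[OF rs(2) _ \<theta>(2) \<open>m > 1\<close>] tame by (auto simp: K.residual_unit_def)
  have "(r / \<theta>) ^ m = 1" "r / \<theta> \<noteq> 1" "r / \<theta> \<in> T"
    using r \<theta> rs(1) by (auto simp: power_divide T.divide)
  with root_of_unity_in_base[OF complete tame] that show ?thesis by blast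
qed

end


theorem theorem1p6:
  fixes K L N :: "'a::field set" and v w :: "'a \<Rightarrow> int" and e n q :: nat
  assumes K_local: "local_field K v"
    and L_local: "local_field L w"
    and L_over_K: "val_over K v w e"
    and finite: "finite_ext K L"
    and separable: "separable_ext K L"
    and N_closure: "galois_closure K L N"
    and n_def: "n = ext_degree K L"
    and q_def: "q = card (carrier (residue_field K v))"
    and tot_ram: "totally_ramified K v L"
    and tame: "gcd n q = 1"
  shows "(exceptional K v L N \<longleftrightarrow> gcd n (q - 1) = 1)
    \<and> (gcd n (q - 1) = 1 \<longleftrightarrow> (\<forall>\<zeta>\<in>K. \<zeta> ^ n = 1 \<longrightarrow> \<zeta> = 1))
    \<and> ((\<forall>\<zeta>\<in>K. \<zeta> ^ n = 1 \<longrightarrow> \<zeta> = 1)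
        \<longleftrightarrow> \<not> (\<exists>M. subfield M amb \<and> K \<subseteq> M \<and> M \<subseteq> L \<and> M \<noteq> K \<and> galois_ext K M))"
proof -
  interpret K: finite_residue_field K v
    using K_local by (auto simp: local_field_def finite_residue_field_def valued_field_def subfld_def
        finite_residue_field_axioms_def valued_field_axioms_def)
  have complete: "K.val_complete"
    using K_local K.mcomplete_imp_val_complete by (auto simp: local_field_def)
  obtain w' where "totally_ramified_ext K v L w' n"
    using totally_ramifiedE[OF K.valued_field_axioms tot_ram] n_def by blast
  then interpret L: totally_ramified_ext K v L w' n .
  have unit: "K.residual_unit n"
    using tame L.m_pos by (intro K.residual_unit_if_coprime) (auto simp: q_def)
  have coprime: "gcd n (q - 1) = 1 \<longleftrightarrow> (\<forall>\<zeta>\<in>K. \<zeta> ^ n = 1 \<longrightarrow> \<zeta> = 1)"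
    using K.coprime_iff_no_roots_of_unity[OF complete, of n] tame L.m_pos by (simp add: q_def)
  obtain \<theta> where \<theta>: "\<theta> \<in> L" "\<theta> \<noteq> 0" "w' \<theta> = 1" "\<theta> ^ n \<in> K"
    using L.tame_radical_uniformizer[OF complete unit] .
  have N: "galois_ext K N" "L \<subseteq> N"
    using N_closure by (auto simp: galois_closure_def)
  interpret N: normal_extension K N
    using N(1) by (intro normal_extensionI) (simp add: galois_ext_def)
  interpret tame_galois K v L w' n N \<theta>
    by unfold_locales (use N \<theta> complete unit in auto)
  let ?no_roots = "\<forall>\<zeta>\<in>K. \<zeta> ^ n = 1 \<longrightarrow> \<zeta> = 1"
  let ?M = "\<exists>M. subfield M amb \<and> K \<subseteq> M \<and> M \<subseteq> L \<and> M \<noteq> K \<and> galois_ext K M"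
  have exceptional: "exceptional K v L N \<longleftrightarrow> ?no_roots"
  proof
    assume exc: "exceptional K v L N"
    show ?no_roots
    proof (intro ballI impI, rule ccontr)
      fix \<zeta> assume "\<zeta> \<in> K" "\<zeta> ^ n = 1" "\<zeta> \<noteq> 1"
      then obtain \<sigma> where "\<sigma> \<in> Gal N K - Gal N L" "compositum L (\<sigma> ` L) = L"
        using automorphism_preserving_L by blast
      with exc tot_ram show False
        unfolding exceptional_def by metis
    qed
  next
    assume ?no_roots
    with tot_ram show "exceptional K v L N"
      using compositum_not_totally_ramified by (simp add: exceptional_def)
  qed
  have kummer: "?M" if no: "\<not> ?no_roots"
    using no kummer_subextension by blast
  have root: "\<not> ?no_roots" if M: ?M
  proof -
    obtain M where M: "subfield M amb" "K \<subseteq> M" "M \<subseteq> L" "M \<noteq> K" "normal_ext K M"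
      using M by (auto simp: galois_ext_def)
    \<comment> \<open>Since \<open>k\<close> divides \<open>n\<close>, \<open>M\<close> is again
      tame, and a nontrivial \<open>k\<close>-th root of unity is also an \<open>n\<close>-th
      one.\<close>
    obtain u k where u: "totally_ramified_ext K v M u k" and k: "k dvd n" "k > 1"
      using L.intermediate_totally_ramified[OF M(1-4)] .
    obtain \<zeta> where \<zeta>: "\<zeta> \<in> K" "\<zeta> ^ k = 1" "\<zeta> \<noteq> 1"
      using totally_ramified_ext.galois_root_of_unity[OF u complete
          K.residual_unit_dvd[OF unit k(1)] k(2) M(5)] .
    have "\<zeta> ^ n = 1"
      using \<zeta>(2) k(1) by (auto simp: power_mult)
    with \<zeta> show ?thesis by blast
  qed
  show ?thesis
  proof (intro conjI)
    show "exceptional K v L N \<longleftrightarrow> gcd n (q - 1) = 1"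
      using exceptional coprime by (simp only:)
    show "gcd n (q - 1) = 1 \<longleftrightarrow> ?no_roots"
      by (rule coprime)
    show "?no_roots \<longleftrightarrow> \<not> ?M"
      using kummer root by argo
  qed
qed

end
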